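(* Let $p\ge 3$ be an integer and let $a,b$ be real numbers such that either (i) $-\frac p2<a\le-\frac32$ and $0<b<1$, or (ii) $-\frac32<a<\frac p2-2$ and $\frac{8a+12}{2a+3p}\le b<1$. Assume moreover that $\Psi(b,p/2+a)\ge 0$. Then the (generalized) Bayes estimator $$\hat{\beta}(y)=\left(1-\frac{\int_0^1\kappa^{p/2+a}(1-\kappa)^{b-1}\exp(-\kappa\|y\|^2/2)\,d\kappa}{\int_0^1\kappa^{p/2+a-1}(1-\kappa)^{b-1}\exp(-\kappa\|y\|^2/2)\,d\kappa}\right)y$$ under the prior $\pi(\kappa)=\kappa^{a-1}(1-\kappa)^{b-1}$ on $\kappa\in(0,1)$ is minimax for estimating $\beta\in\mathbb{R}^p$ from $y\mid\beta\sim\mathcal{N}_p(\beta,I_p)$ under the quadratic loss $\|\hat\beta-\beta\|^2$.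
   Context: The hierarchical model is $y\mid\beta\sim\mathcal{N}_p(\beta,I_p)$, $\beta\mid\kappa\sim\mathcal{N}_p\bigl(0,\frac{1-\kappa}{\kappa}I_p\bigr)$, with the (possibly improper) prior $\pi(\kappa)=\kappa^{a-1}(1-\kappa)^{b-1}$ on $\kappa\in(0,1)$. The norm $\|\cdot\|$ is Euclidean. For $0<b<1$ and $q>0$ define $$\Psi(b,q)=\frac43\,\frac{b}{1-b}\,\frac{b+q+1}{b+q+2}-2\psi\{\zeta(b,q)\}-\bigl[\psi\{\zeta(b,q)\}\bigr]^2,$$ $$\zeta(b,q)=\frac29\,\frac{b^2}{(b+1)(b+2)}\,\frac{(b+q+3)(b+q+4)}{(b+q+2)^2},$$ $$\psi(\zeta)=\zeta^{1/3}\left\{(1+\sqrt{1-\zeta})^{1/3}+(1-\sqrt{1-\zeta})^{1/3}\right\}.$$ The risk of an estimator $\delta:\mathbb{R}^p\to\mathbb{R}^p$ at $\beta$ is $R(\beta,\delta)=E_\beta[\|\delta(Y)-\beta\|^2]$, where $Y\sim\mathcal{N}_p(\beta,I_p)$. An estimator $\delta$ is minimax if $\sup_{\beta\in\mathbb{R}^p}R(\beta,\delta)=\inf_{\delta'}\sup_{\beta\in\mathbb{R}^p}R(\beta,\delta')$, the infimum being over all estimators. It is well known that the usual estimator $\delta(y)=y$ is minimax, with constant risk $p$; hence $\delta$ is minimax if and only if $R(\beta,\delta)\le p$ for all $\beta\in\mathbb{R}^p$. *)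

theory Defs
  imports "HOL-Probability.Probability"
begin

text \<open>The dimension \<open>p\<close> is \<open>CARD('n)\<close>.  In \<open>mvn_density \<mu> v\<close>, the density of
  \<open>N(\<mu>, v I)\<close>, the parameter \<open>v\<close> is the variance, whereas the library's
  \<open>normal_density\<close> takes the standard deviation.\<close>

definition mvn_density :: "real ^ 'n \<Rightarrow> real \<Rightarrow> real ^ 'n \<Rightarrow> real" where
  "mvn_density \<mu> v x = (\<Prod>i\<in>UNIV. normal_density (\<mu> $ i) (sqrt v) (x $ i))"

definition mvn :: "real ^ 'n \<Rightarrow> real \<Rightarrow> (real ^ 'n) measure" where
  "mvn \<mu> v = density lborel (\<lambda>x. ennreal (mvn_density \<mu> v x))"


text \<open>Estimators are Borel functions of the observation.  Risks are extended nonnegative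
  reals, so every estimator has a risk, possibly infinite.\<close>

definition risk :: "real ^ 'n \<Rightarrow> (real ^ 'n \<Rightarrow> real ^ 'n) \<Rightarrow> ennreal" where
  "risk \<beta> \<delta> = (\<integral>\<^sup>+ y. ennreal ((norm (\<delta> y - \<beta>))\<^sup>2) \<partial>mvn \<beta> 1)"

definition minimax :: "(real ^ 'n \<Rightarrow> real ^ 'n) \<Rightarrow> bool" where
  "minimax \<delta> \<longleftrightarrow> \<delta> \<in> borel_measurable borel \<and>
     (SUP \<beta>. risk \<beta> \<delta>) = (INF (\<delta>' :: real ^ 'n \<Rightarrow> real ^ 'n) \<in> borel_measurable borel. SUP \<beta>. risk \<beta> \<delta>')"


text \<open>A generalized Bayes estimator for a possibly improper prior density \<open>\<pi>\<close>: the formal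
  posterior, proportional to likelihood times \<open>\<pi>\<close>, can be normalized, and \<open>\<delta> y\<close> minimizes
  the posterior expected quadratic loss.  Finiteness of the minimum excludes the degenerate
  case in which every decision has infinite posterior loss.\<close>

definition marginal :: "(real ^ 'n \<Rightarrow> ennreal) \<Rightarrow> real ^ 'n \<Rightarrow> ennreal" where
  "marginal \<pi> y = (\<integral>\<^sup>+ \<beta>. ennreal (mvn_density \<beta> 1 y) * \<pi> \<beta> \<partial>lborel)"

definition posterior_loss ::
    "(real ^ 'n \<Rightarrow> ennreal) \<Rightarrow> real ^ 'n \<Rightarrow> real ^ 'n \<Rightarrow> ennreal" where
  "posterior_loss \<pi> y d =
     (\<integral>\<^sup>+ \<beta>. ennreal ((norm (d - \<beta>))\<^sup>2) * (ennreal (mvn_density \<beta> 1 y) * \<pi> \<beta>) \<partial>lborel)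
       / marginal \<pi> y"

definition generalized_bayes ::
    "(real ^ 'n \<Rightarrow> ennreal) \<Rightarrow> (real ^ 'n \<Rightarrow> real ^ 'n) \<Rightarrow> bool" where
  "generalized_bayes \<pi> \<delta> \<longleftrightarrow> \<delta> \<in> borel_measurable borel \<and>
     (\<forall>y. 0 < marginal \<pi> y \<and> marginal \<pi> y < \<infinity> \<and>
          posterior_loss \<pi> y (\<delta> y) < \<infinity> \<and>
          (\<forall>d. posterior_loss \<pi> y (\<delta> y) \<le> posterior_loss \<pi> y d))"


definition kappa_prior :: "real \<Rightarrow> real \<Rightarrow> real \<Rightarrow> real" where
  "kappa_prior a b \<kappa> = \<kappa> powr (a - 1) * (1 - \<kappa>) powr (b - 1)"

text \<open>The prior density of \<open>\<beta>\<close> in the hierarchical model, with \<open>\<kappa>\<close> integrated out.  It may be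
  infinite at \<open>\<beta> = 0\<close>, which is a null set.\<close>

definition beta_prior :: "real \<Rightarrow> real \<Rightarrow> real ^ 'n \<Rightarrow> ennreal" where
  "beta_prior a b \<beta> =
     (\<integral>\<^sup>+ \<kappa>\<in>{0<..<1}. ennreal (mvn_density 0 ((1 - \<kappa>) / \<kappa>) \<beta> * kappa_prior a b \<kappa>) \<partial>lborel)"

definition beta_hat :: "real \<Rightarrow> real \<Rightarrow> real ^ 'n \<Rightarrow> real ^ 'n" where
  "beta_hat a b y =
     (1 - (LBINT \<kappa>:{0<..<1}. \<kappa> powr (real CARD('n) / 2 + a) * (1 - \<kappa>) powr (b - 1)
                               * exp (- \<kappa> * (norm y)\<^sup>2 / 2))
          / (LBINT \<kappa>:{0<..<1}. \<kappa> powr (real CARD('n) / 2 + a - 1) * (1 - \<kappa>) powr (b - 1)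
                               * exp (- \<kappa> * (norm y)\<^sup>2 / 2))) *\<^sub>R y"


definition psi :: "real \<Rightarrow> real" where
  "psi z = root 3 z * (root 3 (1 + sqrt (1 - z)) + root 3 (1 - sqrt (1 - z)))"

definition zeta :: "real \<Rightarrow> real \<Rightarrow> real" where
  "zeta b q = 2 / 9 * (b\<^sup>2 / ((b + 1) * (b + 2)))
                * ((b + q + 3) * (b + q + 4) / (b + q + 2)\<^sup>2)"

definition Psi :: "real \<Rightarrow> real \<Rightarrow> real" where
  "Psi b q = 4 / 3 * (b / (1 - b)) * ((b + q + 1) / (b + q + 2))
               - 2 * psi (zeta b q) - (psi (zeta b q))\<^sup>2"

end

theory Submission
  imports Defs
begin

text \<open>Let \<open>q = p/2 + a\<close>, \<open>v = ||y||^2/2\<close>, and let \<open>D\<close>, \<open>N\<close>, \<open>M\<close> be the integrals of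
  \<open>\<kappa>^k (1 - \<kappa>)^(b - 1) exp (- \<kappa> v)\<close> for \<open>k = q - 1, q, q + 1\<close>, so that the estimator is
  \<open>(1 - N/D) y\<close>.  By Stein's identity its risk is at most \<open>p\<close> as soon as
  \<open>2 v M/N - v N/D \<le> p\<close> for all \<open>v \<ge> 0\<close>.  If \<open>v N/D \<le> q\<close>, the contiguous relation
  \<open>v (N - M) = q D - (q + b) N\<close> bounds the left-hand side by \<open>q + 2 b\<close>.  Otherwise it suffices that
  \<open>v M/N \<le> 3 (q + 1)/(b + 2)\<close>, because the hypotheses on \<open>a\<close> and \<open>b\<close> say that
  \<open>p \<ge> 6 (q + 1)/(b + 2) - q\<close>.  In the power series of \<open>3 (q + 1) N - (b + 2) v M\<close> (times \<open>exp v\<close>)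
  only the coefficients of \<open>v\<close> and \<open>v^2\<close> are negative and that of \<open>v^3\<close> vanishes; the quartic
  Taylor polynomial has its minimum over \<open>v \<ge> 0\<close> at the root of a cubic, which Cardano's formula
  expresses through \<open>psi\<close>, and \<open>Psi b q \<ge> 0\<close> says that this minimum is nonnegative.\<close>

section \<open>Kummer-type integrals\<close>

text \<open>\<open>beta_exp s b v\<close> is \<open>exp v\<close> times the integral of
  \<open>\<kappa> powr (s - 1) * (1 - \<kappa>) powr (b - 1) * exp (- \<kappa> v)\<close> over \<open>(0, 1)\<close>, that is,
  \<open>Beta s b\<close> times Kummer's function \<open>M(b, b + s, v)\<close>.\<close>

definition beta_exp :: "real \<Rightarrow> real \<Rightarrow> real \<Rightarrow> real" where
  "beta_exp s b v = (\<Sum>n. Beta s (b + real n) / fact n * v ^ n)"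

lemma pos_not_nonpos_Ints: "x > 0 \<Longrightarrow> x \<notin> \<int>\<^sub>\<le>\<^sub>0" for x :: real
  by (auto elim!: nonpos_Ints_cases')

lemma Beta_real_pos: "s > 0 \<Longrightarrow> b > 0 \<Longrightarrow> Beta s b > 0" for s b :: real
  by (simp add: Beta_def Gamma_real_pos)

text \<open>The recurrence in the second argument has the factor
  \<open>(b + n) / (s + b + n)\<close>, which is at most 1. The bound lets an exponential series
  dominate the series of \<open>beta_exp\<close>.\<close>

lemma Beta_add_nat_le:
  fixes s b :: real
  assumes "s > 0" "b > 0"
  shows "Beta s (b + real n) \<le> Beta s b"
proof (induction n)
  case (Suc n)
  have eq: "(s + (b + n)) * Beta s (b + n + 1) = (b + n) * Beta s (b + n)"
    using assms by (intro Beta_plus1_right pos_not_nonpos_Ints) auto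
  have "(b + n) * Beta s (b + n) \<le> (s + (b + n)) * Beta s (b + n)"
    using assms Beta_real_pos[of s "b + n"] by (intro mult_right_mono) auto
  hence "Beta s (b + n + 1) \<le> Beta s (b + n)"
    using assms eq[symmetric] by simp
  thus ?case using Suc by (simp add: add_ac)
qed simp

lemma summable_beta_exp:
  fixes s b v :: real
  assumes "s > 0" "b > 0"
  shows "summable (\<lambda>n. Beta s (b + real n) / fact n * v ^ n)"
proof (rule summable_comparison_test')
  show "summable (\<lambda>n. Beta s b * (inverse (fact n) * \<bar>v\<bar> ^ n))"
    by (intro summable_mult summable_exp)
  fix n :: nat
  show "norm (Beta s (b + real n) / fact n * v ^ n) \<le> Beta s b * (inverse (fact n) * \<bar>v\<bar> ^ n)"
    using Beta_add_nat_le[OF assms, of n] Beta_real_pos[of s "b + n"] assms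
    by (simp add: abs_mult power_abs divide_inverse mult_right_mono)
qed

lemma beta_exp_pos:
  assumes "s > 0" "b > 0" "v \<ge> 0"
  shows "beta_exp s b v > 0"
  unfolding beta_exp_def
\<comment> \<open>The strictly positive term is the one at index 0: it equals
  \<open>Beta s b\<close>, also at \<open>v = 0\<close>, since \<open>0 ^ 0 = 1\<close>.\<close>
proof (rule suminf_pos2[OF summable_beta_exp, of _ _ _ 0])
  show "0 \<le> Beta s (b + real n) / fact n * v ^ n" for n
    using assms Beta_real_pos[of s "b + n"] by simp
qed (use assms Beta_real_pos in auto)

text \<open>Under the integral this is \<open>\<kappa> + (1 - \<kappa>) = 1\<close>. It compares
  neighbours in \<open>s\<close>, and it turns the derivative into a difference of such
  neighbours.\<close>

lemma beta_exp_split: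
  assumes "s > 0" "b > 0"
  shows "beta_exp s b v = beta_exp (s + 1) b v + beta_exp s (b + 1) v"
proof -
  have "beta_exp (s + 1) b v + beta_exp s (b + 1) v =
      (\<Sum>n. Beta (s + 1) (b + real n) / fact n * v ^ n + Beta s (b + 1 + real n) / fact n * v ^ n)"
    unfolding beta_exp_def using assms by (intro suminf_add summable_beta_exp) auto
  also have "\<dots> = beta_exp s b v"
    unfolding beta_exp_def
  proof (rule arg_cong[where f = suminf], rule ext)
    fix n :: nat
    have "Beta (s + 1) (b + n) + Beta s (b + n + 1) = Beta s (b + n)"
      using assms by (intro Beta_plus1_plus1 pos_not_nonpos_Ints) auto
    thus "Beta (s + 1) (b + real n) / fact n * v ^ n + Beta s (b + 1 + real n) / fact n * v ^ n
        = Beta s (b + real n) / fact n * v ^ n"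
      by (metis (no_types, lifting) add.assoc add.commute add_divide_distrib distrib_right)
  qed
  finally show ?thesis ..
qed

text \<open>With the factor \<open>exp v\<close> included, the integrand depends on \<open>v\<close>
  through \<open>exp ((1 - \<kappa>) v)\<close>, so differentiation raises \<open>b\<close> and not
  \<open>s\<close>.\<close>

lemma beta_exp_deriv:
  assumes "s > 0" "b > 0"
  shows "(beta_exp s b has_real_derivative beta_exp s (b + 1) v) (at v)"
proof -
  have "diffs (\<lambda>n. Beta s (b + real n) / fact n) = (\<lambda>n. Beta s (b + 1 + real n) / fact n)"
    by (rule ext) (simp add: diffs_def add_ac)
  thus ?thesis
    using termdiffs_strong_converges_everywhere[of "\<lambda>n. Beta s (b + real n) / fact n", OF summable_beta_exp[OF assms], of v]
    unfolding beta_exp_def[abs_def] by simp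
qed

text \<open>This is the Euler operator \<open>v d/dv\<close>, which multiplies the n-th coefficient
  by \<open>n\<close>.\<close>

lemma beta_exp_mult_sums:
  assumes "s > 0" "b > 0"
  shows "(\<lambda>n. real n * (Beta s (b + real n) / fact n * v ^ n)) sums (v * beta_exp s (b + 1) v)"
proof -
  have "(\<lambda>n. v * (Beta s (b + 1 + real n) / fact n * v ^ n)) sums (v * beta_exp s (b + 1) v)"
    unfolding beta_exp_def using assms
    by (intro sums_mult summable_sums summable_beta_exp) auto
  also have "(\<lambda>n. v * (Beta s (b + 1 + real n) / fact n * v ^ n)) =
     (\<lambda>n. real (Suc n) * (Beta s (b + real (Suc n)) / fact (Suc n) * v ^ Suc n))"
  proof
    fix n :: nat
    have eq: "b + real (Suc n) = b + 1 + real n" by simp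
    show "v * (Beta s (b + 1 + real n) / fact n * v ^ n) = real (Suc n) * (Beta s (b + real (Suc n)) / fact (Suc n) * v ^ Suc n)"
      unfolding eq by (simp del: of_nat_Suc)
  qed
  finally show ?thesis
    by (subst (asm) sums_Suc_iff) simp
qed

text \<open>By \<open>s Beta s (b + n) = (s + b + n) Beta (s + 1) (b + n)\<close>, the n-th
  coefficient on the right is \<open>n\<close> times that of \<open>beta_exp (s + 1) b\<close>, so
  the series is \<open>v\<close> times its derivative. Analytically this is an integration by parts
  in \<kappa>.\<close>

lemma beta_exp_contiguous:
  assumes "s > 0" "b > 0"
  shows "v * (beta_exp (s + 1) b v - beta_exp (s + 2) b v) = s * beta_exp s b v - (s + b) * beta_exp (s + 1) b v"
proof -
  have "(\<lambda>n. s * (Beta s (b + real n) / fact n * v ^ n) - (s + b) * (Beta (s + 1) (b + real n) / fact n * v ^ n))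
      sums (s * beta_exp s b v - (s + b) * beta_exp (s + 1) b v)"
    unfolding beta_exp_def using assms
    by (intro sums_diff sums_mult summable_sums summable_beta_exp) auto
  also have "(\<lambda>n. s * (Beta s (b + real n) / fact n * v ^ n) - (s + b) * (Beta (s + 1) (b + real n) / fact n * v ^ n))
     = (\<lambda>n. real n * (Beta (s + 1) (b + real n) / fact n * v ^ n))"
  proof (rule ext)
    fix n :: nat
    have "(s + (b + n)) * Beta (s + 1) (b + n) = s * Beta s (b + n)"
      using assms by (intro Beta_plus1_left pos_not_nonpos_Ints) auto
    hence "s * Beta s (b + n) - (s + b) * Beta (s + 1) (b + n) = n * Beta (s + 1) (b + n)"
      by (simp add: algebra_simps)
    moreover have "s * (Beta s (b + real n) / fact n * v ^ n) - (s + b) * (Beta (s + 1) (b + real n) / fact n * v ^ n)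
       = (s * Beta s (b + n) - (s + b) * Beta (s + 1) (b + n)) / fact n * v ^ n"
      by (simp add: field_simps)
    ultimately show "s * (Beta s (b + real n) / fact n * v ^ n) - (s + b) * (Beta (s + 1) (b + real n) / fact n * v ^ n)
     = real n * (Beta (s + 1) (b + real n) / fact n * v ^ n)" by simp
  qed
  finally have "s * beta_exp s b v - (s + b) * beta_exp (s + 1) b v = v * beta_exp (s + 1) (b + 1) v"
    using beta_exp_mult_sums[of "s + 1" b v] assms sums_unique2 by fastforce
  moreover have "beta_exp (s + 1) b v = beta_exp (s + 2) b v + beta_exp (s + 1) (b + 1) v"
    using beta_exp_split[of "s + 1" b v] assms by (simp add: add_ac)
  ultimately show ?thesis by simp
qed

section \<open>Integral representation of \<open>beta_exp\<close>\<close>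

lemma beta_integral:
  fixes s b :: real
  assumes "s > 0" "b > 0"
  shows "has_bochner_integral lborel (\<lambda>t. indicator {0<..<1} t *\<^sub>R (t powr (s - 1) * (1 - t) powr (b - 1))) (Beta s b)"
proof -
  have 1: "((\<lambda>t. t powr (s - 1) * (1 - t) powr (b - 1)) has_integral Beta s b) {0..1}"
    using has_integral_Beta_real[OF assms] .
  hence "((\<lambda>t. t powr (s - 1) * (1 - t) powr (b - 1)) has_integral Beta s b) {0<..<1}"
    by (simp add: has_integral_Icc_iff_Ioo)
  hence 2: "((\<lambda>t. indicator {0<..<1} t *\<^sub>R (t powr (s - 1) * (1 - t) powr (b - 1))) has_integral Beta s b) UNIV"
    by (subst (asm) has_integral_restrict_UNIV[symmetric]) (simp add: indicator_def of_bool_def if_distrib if_distribR cong: if_cong)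
  \<comment> \<open>Nonnegativity of the integrand allows the passage from the gauge integral to the
    Lebesgue integral.\<close>
  show ?thesis
    by (rule has_bochner_integral_nn_integral)
       (use 2 assms Beta_real_pos[OF assms] in \<open>auto intro!: nn_integral_has_integral_lborel simp: indicator_def\<close>)
qed

text \<open>Expanding \<open>exp ((1 - t) * v)\<close> in powers of \<open>1 - t\<close> makes each
  term a Beta integral with second argument \<open>b + n\<close>. All terms are nonnegative, so
  convergence of the series of integrals justifies termwise integration.\<close>

lemma beta_exp_integral:
  fixes s b v :: real
  assumes "s > 0" "b > 0" "v \<ge> 0"
  shows "has_bochner_integral lborel
     (\<lambda>t. indicator {0<..<1} t *\<^sub>R (t powr (s - 1) * (1 - t) powr (b - 1) * exp (- t * v))) (exp (- v) * beta_exp s b v)"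
proof -
  define f where "f n t = indicator {0<..<1} t *\<^sub>R (t powr (s - 1) * (1 - t) powr (b + real n - 1)) * (v ^ n / fact n)" for n t
  have f: "has_bochner_integral lborel (f n) (Beta s (b + n) * (v ^ n / fact n))" for n
    unfolding f_def using assms by (intro has_bochner_integral_mult_left beta_integral) auto
  have nn: "f n t \<ge> 0" for n t using assms by (auto simp: f_def indicator_def)
  have fs: "(\<lambda>n. f n t) sums (exp v * (indicator {0<..<1} t *\<^sub>R (t powr (s - 1) * (1 - t) powr (b - 1) * exp (- t * v))))" for t
  proof (cases "t \<in> {0<..<1}")
    case True
    have "(\<lambda>n. t powr (s - 1) * (1 - t) powr (b - 1) * (inverse (fact n) * ((1 - t) * v) ^ n)) sums
       (t powr (s - 1) * (1 - t) powr (b - 1) * exp ((1 - t) * v))"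
      using exp_converges[of "(1 - t) * v"] by (intro sums_mult) (simp add: divide_inverse mult.commute)
    also have "(\<lambda>n. t powr (s - 1) * (1 - t) powr (b - 1) * (inverse (fact n) * ((1 - t) * v) ^ n)) = (\<lambda>n. f n t)"
    proof
      fix n :: nat
      have "(1 - t) powr (b + real n - 1) = (1 - t) powr (b - 1) * (1 - t) ^ n"
        using True powr_add[of "1 - t" "b - 1" "real n"] by (simp add: powr_realpow algebra_simps)
      thus "t powr (s - 1) * (1 - t) powr (b - 1) * (inverse (fact n) * ((1 - t) * v) ^ n) = f n t"
        using True by (simp add: f_def power_mult_distrib divide_inverse)
    qed
    also have "exp ((1 - t) * v) = exp v * exp (- t * v)" by (simp add: exp_add[symmetric] algebra_simps)
    finally show ?thesis using True by (simp add: mult_ac)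
  qed (simp add: f_def)
  have sm: "summable (\<lambda>n. integral\<^sup>L lborel (\<lambda>t. norm (f n t)))"
    using summable_beta_exp[OF assms(1,2), of v] has_bochner_integral_integral_eq[OF f] nn by simp
  have int: "integrable lborel (f n)" for n using f by (simp add: has_bochner_integral_iff)
  have AE: "AE t in lborel. summable (\<lambda>n. norm (f n t))"
    using fs nn by (auto intro!: AE_I2 sums_summable)
  have "has_bochner_integral lborel (\<lambda>t. \<Sum>n. f n t) (\<Sum>n. integral\<^sup>L lborel (f n))"
    using integrable_suminf[OF int AE sm] integral_suminf[OF int AE sm] by (simp add: has_bochner_integral_iff)
  also have "(\<lambda>t. \<Sum>n. f n t) = (\<lambda>t. exp v * (indicator {0<..<1} t *\<^sub>R (t powr (s - 1) * (1 - t) powr (b - 1) * exp (- t * v))))"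
    using sums_unique[OF fs] by auto
  also have "(\<Sum>n. integral\<^sup>L lborel (f n)) = beta_exp s b v"
    unfolding beta_exp_def using has_bochner_integral_integral_eq[OF f] by simp
  finally have "has_bochner_integral lborel (\<lambda>t. exp (- v) * (exp v * (indicator {0<..<1} t *\<^sub>R (t powr (s - 1) * (1 - t) powr (b - 1) * exp (- t * v))))) (exp (- v) * beta_exp s b v)"
    by (rule has_bochner_integral_mult_right)
  thus ?thesis by (simp add: mult.assoc[symmetric] exp_minus)
qed

section \<open>The quartic Taylor polynomial and the pointwise inequality\<close>

lemma psi_pos: "0 < z \<Longrightarrow> z \<le> 1 \<Longrightarrow> psi z > 0"
  by (auto simp: psi_def intro!: mult_pos_pos add_pos_nonneg real_sqrt_ge_zero add_nonneg_pos)

text \<open>\<open>psi z\<close> is Cardano's formula for the positive root of \<open>x^3 - 3 z x - 2 z\<close>.\<close>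

lemma psi_cubic:
  assumes "0 < z" "z \<le> 1"
  shows "psi z ^ 3 = z * (3 * psi z + 2)"
proof -
  define A B where "A = root 3 (1 + sqrt (1 - z))" and "B = root 3 (1 - sqrt (1 - z))"
  have A3: "A ^ 3 = 1 + sqrt (1 - z)" and B3: "B ^ 3 = 1 - sqrt (1 - z)"
    using assms by (auto simp: A_def B_def odd_real_root_pow)
  have r3: "root 3 z ^ 3 = z" by (simp add: odd_real_root_pow)
  have "A * B = root 3 ((1 + sqrt (1 - z)) * (1 - sqrt (1 - z)))"
    unfolding A_def B_def by (simp add: real_root_mult)
  also have "(1 + sqrt (1 - z)) * (1 - sqrt (1 - z)) = 1 - (sqrt (1 - z))\<^sup>2"
    by (simp add: algebra_simps power2_eq_square)
  also have "\<dots> = z" using assms by simp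
  finally have AB: "A * B = root 3 z" .
  have psi: "psi z = root 3 z * (A + B)" by (simp add: psi_def A_def B_def)
  have "psi z ^ 3 = z * (A + B) ^ 3" unfolding psi by (simp add: power_mult_distrib r3)
  also have "(A + B) ^ 3 = A ^ 3 + B ^ 3 + 3 * (A * B) * (A + B)"
    by (simp add: algebra_simps power3_eq_cube)
  also have "\<dots> = 3 * psi z + 2" unfolding A3 B3 AB psi by simp
  finally show ?thesis .
qed

text \<open>The upper bound keeps \<open>1 - zeta b q\<close> nonnegative, so that Cardano's formula
  involves real roots only. Bounding the last two factors of \<open>zeta\<close> by 1 and 4 is
  enough, since \<open>2 / 9 * 4 < 1\<close>.\<close>

lemma zeta_bounds:
  assumes "0 < b" "b < 1" "0 < q"
  shows "0 < zeta b q" "zeta b q \<le> 1"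
proof -
  have "b\<^sup>2 / ((b + 1) * (b + 2)) \<le> 1"
  proof -
    have "b\<^sup>2 \<le> (b + 1) * (b + 2)"
      unfolding power2_eq_square using assms by (intro mult_mono) auto
    thus ?thesis using assms by simp
  qed
  moreover have "(b + q + 3) * (b + q + 4) / (b + q + 2)\<^sup>2 \<le> 4"
  proof -
    have "(b + q + 3) * (b + q + 4) \<le> (2 * (b + q + 2)) * (2 * (b + q + 2))"
      using assms by (intro mult_mono) auto
    also have "\<dots> = 4 * (b + q + 2)\<^sup>2" by algebra
    finally show ?thesis using assms by (simp add: divide_simps)
  qed
  ultimately have "(b\<^sup>2 / ((b + 1) * (b + 2))) * ((b + q + 3) * (b + q + 4) / (b + q + 2)\<^sup>2) \<le> 1 * 4"
    using assms by (intro mult_mono) auto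
  hence "zeta b q \<le> 2 / 9 * (1 * 4)"
    unfolding zeta_def mult.assoc[of "2 / 9"] by (intro mult_left_mono) auto
  thus "zeta b q \<le> 1" by simp
  show "0 < zeta b q" using assms unfolding zeta_def by simp
qed

text \<open>The quartic attains its minimum over \<open>s \<ge> 0\<close> at \<open>psi z\<close>, the positive root of its derivative.\<close>

lemma quartic_min:
  assumes "0 < z" "z \<le> 1" "0 \<le> s"
  shows "s ^ 4 / z - 6 * s\<^sup>2 - 8 * s \<ge> - 3 * (2 * psi z + (psi z)\<^sup>2)"
proof -
  define x where "x = psi z"
  have x: "x > 0" "x ^ 3 = z * (3 * x + 2)"
    using psi_pos psi_cubic assms unfolding x_def by auto
  \<comment> \<open>The cubic equation eliminates \<open>z\<close>, so that the claim becomes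
    polynomial in \<open>s\<close> and \<open>x\<close>.\<close>
  have z: "1 / z = (3 * x + 2) / x ^ 3"
  proof -
    have "x ^ 3 \<noteq> 0" using x(1) by simp
    thus ?thesis using x(2) assms by (metis eq_divide_eq less_irrefl mult.commute mult.right_neutral times_divide_eq_right)
  qed
  \<comment> \<open>After multiplication by \<open>x ^ 3\<close>, the gap between the quartic and
    its minimum has a double root at \<open>s = x\<close>, and the cofactor has nonnegative
    coefficients.\<close>
  have "0 \<le> (s - x)\<^sup>2 * ((3 * x + 2) * s\<^sup>2 + (6 * x\<^sup>2 + 4 * x) * s + 3 * x ^ 3 + 6 * x\<^sup>2)"
    using x assms by (intro mult_nonneg_nonneg add_nonneg_nonneg) auto
  also have "\<dots> = s ^ 4 * (3 * x + 2) - 6 * s\<^sup>2 * x ^ 3 - 8 * s * x ^ 3 + 3 * x ^ 5 + 6 * x ^ 4"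
    by (simp add: algebra_simps power2_eq_square power3_eq_cube eval_nat_numeral)
  also have "\<dots> = x ^ 3 * (s ^ 4 * ((3 * x + 2) / x ^ 3) - 6 * s\<^sup>2 - 8 * s + 3 * (2 * x + x\<^sup>2))"
    using x(1) by (simp add: field_simps eval_nat_numeral)
  finally have "0 \<le> s ^ 4 * (1 / z) - 6 * s\<^sup>2 - 8 * s + 3 * (2 * x + x\<^sup>2)"
    unfolding z using x(1) by (simp add: zero_le_mult_iff)
  thus ?thesis by (simp add: x_def)
qed

text \<open>Up to a positive factor this is the quartic Taylor polynomial of \<open>3 (q + 1)
  beta_exp (q + 1) b v - (b + 2) v beta_exp (q + 2) b v\<close>. Rescaling \<open>v\<close> gives
  \<open>s ^ 4 / zeta b q - 6 s ^ 2 - 8 s + 3 c\<close>, where \<open>c\<close> is the first term of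
  \<open>Psi b q\<close>.\<close>

lemma Psi_imp_quartic:
  assumes "0 < b" "b < 1" "0 < q" "0 \<le> Psi b q" "0 \<le> v"
  shows "3 / (1 - b) - 2 * v / (q + b + 1) - b * v\<^sup>2 / (2 * (q + b + 1) * (q + b + 2))
     + b * (b + 1) * (b + 2) * v ^ 4 / (24 * (q + b + 1) * (q + b + 2) * (q + b + 3) * (q + b + 4)) \<ge> 0"
    (is "?L \<ge> 0")
proof -
  define e where "e = q + b"
  have e: "e > 0" using assms by (simp add: e_def)
  define c where "c = 4 / 3 * (b / (1 - b)) * ((e + 1) / (e + 2))"
  \<comment> \<open>The ratio of the quadratic to the linear term is
    \<open>b v / (4 (e + 2))\<close> in \<open>?L\<close> and \<open>3 s / 4\<close> in the normal
    form; this fixes the scaling.\<close>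
  define s where "s = b * v / (3 * (e + 2))"
  define t where "t = 1 / zeta b q"
  have s: "0 \<le> s" using assms e by (simp add: s_def)
  have v: "v = 3 * s * (e + 2) / b"
  proof -
    have "3 * (e + 2) \<noteq> 0" using e by simp
    hence "3 * (e + 2) * s = b * v" by (simp add: s_def)
    thus ?thesis using assms by (simp add: eq_divide_eq mult_ac)
  qed
  have t: "t = 9 / 2 * ((b + 1) * (b + 2) / b\<^sup>2) * ((e + 2)\<^sup>2 / ((e + 3) * (e + 4)))"
    by (simp add: t_def zeta_def e_def ac_simps)
  have Psi: "2 * psi (zeta b q) + (psi (zeta b q))\<^sup>2 \<le> c"
    using assms(4) unfolding Psi_def c_def e_def by (simp add: add_ac)
  have "s ^ 4 * t - 6 * s\<^sup>2 - 8 * s \<ge> - 3 * (2 * psi (zeta b q) + (psi (zeta b q))\<^sup>2)"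
    using quartic_min[OF zeta_bounds[OF assms(1-3)] s] by (simp add: t_def)
  hence "0 \<le> 3 * c + s ^ 4 * t - 6 * s\<^sup>2 - 8 * s"
    using Psi by argo
  also have "3 * c + s ^ 4 * t - 6 * s\<^sup>2 - 8 * s = 4 / 3 * (b * (e + 1) / (e + 2)) * ?L"
  proof -
    have 1: "4 / 3 * (b * (e + 1) / (e + 2)) * (3 / (1 - b)) = 3 * c"
      unfolding c_def by (simp add: field_simps)
    have 2: "4 / 3 * (b * (e + 1) / (e + 2)) * (2 * v / (e + 1)) = 8 * s"
      using assms e unfolding v by (simp add: divide_simps)
    have 3: "4 / 3 * (b * (e + 1) / (e + 2)) * (b * v\<^sup>2 / (2 * (e + 1) * (e + 2))) = 6 * s\<^sup>2"
      using assms e unfolding v by (simp add: divide_simps power2_eq_square) (simp add: algebra_simps)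
    have 4: "4 / 3 * (b * (e + 1) / (e + 2)) * (b * (b + 1) * (b + 2) * v ^ 4 / (24 * (e + 1) * (e + 2) * (e + 3) * (e + 4))) = s ^ 4 * t"
      using assms e unfolding v t by (simp add: divide_simps eval_nat_numeral) (simp add: algebra_simps)
    have gen: "k * (t0 - t1 - t2 + t4) = k * t0 - k * t1 - k * t2 + k * t4" for k t0 t1 t2 t4 :: real
      by (simp add: algebra_simps)
    show ?thesis unfolding e_def[symmetric] unfolding gen 1 2 3 4 by simp
  qed
  finally have "0 \<le> 4 / 3 * (b * (e + 1) / (e + 2)) * ?L" .
  moreover have "0 < 4 / 3 * (b * (e + 1) / (e + 2))" using assms e by simp
  ultimately show ?thesis by (metis mult_pos_neg not_le)
qed

text \<open>In the series for \<open>3 (q + 1) beta_exp (q + 1) - (b + 2) v beta_exp (q + 2)\<close>, the \<open>n\<close>-th term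
  has the sign of \<open>n - 3\<close> for \<open>n \<ge> 1\<close>.  Already its terms with \<open>n \<le> 4\<close> have a nonnegative sum.\<close>

lemma beta_exp_ratio_bound:
  assumes b: "0 < b" "b < 1" and q: "0 < q" and Psi: "0 \<le> Psi b q" and v: "0 \<le> v"
  shows "(b + 2) * (v * beta_exp (q + 2) b v) \<le> 3 * (q + 1) * beta_exp (q + 1) b v"
proof -
  define X where "X n = Beta (q + 1) (b + real n)" for n
  define A where "A n = X n / fact n * v ^ n" for n
  have XSuc: "X (Suc n) = (b + n) / (q + b + 1 + n) * X n" for n
  proof -
    have "(q + 1 + (b + n)) * Beta (q + 1) (b + n + 1) = (b + n) * Beta (q + 1) (b + n)"
      using b q by (intro Beta_plus1_right pos_not_nonpos_Ints) auto
    thus ?thesis using b q unfolding X_def by (simp add: field_simps)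
  qed
  have Xpos: "X n > 0" for n unfolding X_def using b q by (intro Beta_real_pos) auto
  have A: "A sums beta_exp (q + 1) b v"
    unfolding A_def X_def beta_exp_def using b q by (intro summable_sums summable_beta_exp) auto
  \<comment> \<open>An index shift expresses this series through the same terms \<open>A n\<close>
    as the series of \<open>beta_exp (q + 1) b v\<close>. The factor \<open>n\<close> annihilates
    the term at 0, so the sum may start there.\<close>
  have vN: "(\<lambda>n. (q + 1) * (n / (b + n - 1)) * A n) sums (v * beta_exp (q + 2) b v)"
  proof -
    have "(\<lambda>n. v * (Beta (q + 2) (b + real n) / fact n * v ^ n)) sums (v * beta_exp (q + 2) b v)"
      unfolding beta_exp_def using b q by (intro sums_mult summable_sums summable_beta_exp) auto
    also have "(\<lambda>n. v * (Beta (q + 2) (b + real n) / fact n * v ^ n)) =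
        (\<lambda>n. (q + 1) * (Suc n / (b + Suc n - 1)) * A (Suc n))"
    proof
      fix n :: nat
      have "(q + 1 + (b + n)) * Beta (q + 1 + 1) (b + n) = (q + 1) * X n"
        unfolding X_def using b q by (intro Beta_plus1_left pos_not_nonpos_Ints) auto
      hence "(q + b + 1 + n) * Beta (q + 2) (b + n) = (q + 1) * X n"
        by (simp add: add_ac)
      moreover have "q + b + 1 + n \<noteq> 0" "b + n \<noteq> 0" using b q by auto
      ultimately have "Beta (q + 2) (b + n) = (q + 1) / (b + n) * X (Suc n)"
        unfolding XSuc by (simp add: eq_divide_eq mult_ac)
      thus "v * (Beta (q + 2) (b + real n) / fact n * v ^ n) = (q + 1) * (Suc n / (b + Suc n - 1)) * A (Suc n)"
        unfolding A_def by (simp add: mult_ac del: of_nat_Suc)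
    qed
    finally show ?thesis by (subst (asm) sums_Suc_iff) simp
  qed
  \<comment> \<open>The numerator comes from
    \<open>3 (b + n - 1) - (b + 2) n = (1 - b) (n - 3)\<close>. At \<open>n = 0\<close> the
    denominator is negative as well, since \<open>b < 1\<close>, so that \<open>f 0\<close> is
    nonnegative.\<close>
  define f where "f n = (q + 1) * (1 - b) * ((real n - 3) / (b + n - 1)) * A n" for n
  have ne: "b + real n - 1 \<noteq> 0" for n using b by (cases n) auto
  have "(\<lambda>n. 3 * (q + 1) * A n - (b + 2) * ((q + 1) * (n / (b + n - 1)) * A n)) sums
     (3 * (q + 1) * beta_exp (q + 1) b v - (b + 2) * (v * beta_exp (q + 2) b v))"
    by (intro sums_diff sums_mult A vN)
  also have "(\<lambda>n. 3 * (q + 1) * A n - (b + 2) * ((q + 1) * (n / (b + n - 1)) * A n)) = f"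
  proof
    fix n :: nat
    have "3 - (b + 2) * (n / (b + n - 1)) = (1 - b) * ((real n - 3) / (b + n - 1))"
      using ne[of n] by (simp add: field_simps)
    moreover have "3 * (q + 1) * A n - (b + 2) * ((q + 1) * (n / (b + n - 1)) * A n) = 
        (q + 1) * A n * (3 - (b + 2) * (n / (b + n - 1)))"
      by (simp add: algebra_simps)
    ultimately show "3 * (q + 1) * A n - (b + 2) * ((q + 1) * (n / (b + n - 1)) * A n) = f n"
      unfolding f_def by simp
  qed
  finally have f: "f sums (3 * (q + 1) * beta_exp (q + 1) b v - (b + 2) * (v * beta_exp (q + 2) b v))" .
  have "0 \<le> (q + 1) * (1 - b) * X 0 * (3 / (1 - b) - 2 * v / (q + b + 1) - b * v\<^sup>2 / (2 * (q + b + 1) * (q + b + 2))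
     + b * (b + 1) * (b + 2) * v ^ 4 / (24 * (q + b + 1) * (q + b + 2) * (q + b + 3) * (q + b + 4)))"
    using b q Xpos[of 0] by (intro mult_nonneg_nonneg Psi_imp_quartic Psi v) auto
  also have "\<dots> = (\<Sum>n<5. f n)"
  proof -
    have X1: "X 1 = b / (q + b + 1) * X 0" using XSuc[of 0] by simp
    have X2: "X 2 = (b + 1) / (q + b + 2) * X 1" using XSuc[of 1] by (simp add: numeral_2_eq_2 add_ac)
    have X3: "X 3 = (b + 2) / (q + b + 3) * X 2" using XSuc[of 2] by (simp add: eval_nat_numeral add_ac)
    have X4: "X 4 = (b + 3) / (q + b + 4) * X 3" using XSuc[of 3] by (simp add: eval_nat_numeral add_ac)
    have f: "f n = (q + 1) * (1 - b) * ((real n - 3) / (b + n - 1) * X n / fact n * v ^ n)" for n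
      by (simp add: f_def A_def)
    have 0: "(real 0 - 3) / (b + real 0 - 1) * X 0 / fact 0 * v ^ 0 = X 0 * (3 / (1 - b))"
      using b by (simp add: field_simps)
    have 1: "(real 1 - 3) / (b + real 1 - 1) * X 1 / fact 1 * v ^ 1 = - X 0 * (2 * v / (q + b + 1))"
      using b q unfolding X1 by (simp add: field_simps)
    have 2: "(real 2 - 3) / (b + real 2 - 1) * X 2 / fact 2 * v ^ 2 = - X 0 * (b * v\<^sup>2 / (2 * (q + b + 1) * (q + b + 2)))"
    proof -
      have "b + real 2 - 1 = b + 1" "real 2 - 3 = -1" by simp_all
      thus ?thesis using b q unfolding X2 X1 by (simp add: divide_simps fact_numeral) (simp add: algebra_simps)
    qed
    have 4: "(real 4 - 3) / (b + real 4 - 1) * X 4 / fact 4 * v ^ 4 = 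
      X 0 * (b * (b + 1) * (b + 2) * v ^ 4 / (24 * (q + b + 1) * (q + b + 2) * (q + b + 3) * (q + b + 4)))"
    proof -
      have "b + real 4 - 1 = b + 3" "real 4 - 3 = 1" by simp_all
      thus ?thesis using b q unfolding X4 X3 X2 X1 by (simp add: divide_simps fact_numeral) (simp add: algebra_simps)
    qed
    have "(\<Sum>n<5. f n) = f 0 + f 1 + f 2 + f 3 + f 4" by (simp add: eval_nat_numeral)
    also have "f 3 = 0" by (simp add: f_def)
    finally have S: "(\<Sum>n<5. f n) = f 0 + f 1 + f 2 + 0 + f 4" .
    have gen: "k * x * (t0 - t1 - t2 + t4) = k * (x * t0) + k * (- x * t1) + k * (- x * t2) + 0 + k * (x * t4)"
      for k x t0 t1 t2 t4 :: real by (simp add: algebra_simps)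
    show ?thesis unfolding S unfolding f 0 1 2 4 by (rule gen)
  qed
  also have "\<dots> \<le> suminf f"
  proof (rule sum_le_suminf[OF sums_summable[OF f]])
    fix n :: nat assume "n \<in> - {..<5}"
    hence "n \<ge> 5" by auto
    thus "0 \<le> f n"
      unfolding f_def A_def using b q v Xpos[of n] by (intro mult_nonneg_nonneg divide_nonneg_nonneg) auto
  qed simp
  also have "suminf f = 3 * (q + 1) * beta_exp (q + 1) b v - (b + 2) * (v * beta_exp (q + 2) b v)"
    using sums_unique[OF f] by simp
  finally show ?thesis by simp
qed

lemma shrinkage_inequality:
  assumes b: "0 < b" "b < 1" and q: "0 < q" and Psi: "0 \<le> Psi b q" and v: "0 \<le> v"
    and P: "P \<ge> 6 * (q + 1) / (b + 2) - q"
  shows "2 * (v * beta_exp (q + 2) b v / beta_exp (q + 1) b v) - v * beta_exp (q + 1) b v / beta_exp q b v \<le> P"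
proof -
  define D N M where "D = beta_exp q b v" and "N = beta_exp (q + 1) b v" and "M = beta_exp (q + 2) b v"
  have pos: "D > 0" "N > 0" "M > 0"
    unfolding D_def N_def M_def using b q v by (auto intro!: beta_exp_pos)
  have "N < D"
    using beta_exp_split[OF q b(1), of v] beta_exp_pos[of q "b + 1" v] b q v unfolding N_def D_def by simp
  have ctg: "v * (N - M) = q * D - (q + b) * N"
    unfolding D_def N_def M_def using beta_exp_contiguous[OF q b(1)] .
  define r where "r = N / D"
  have r: "0 < r" "r < 1" using pos \<open>N < D\<close> by (auto simp: r_def)
  \<comment> \<open>The contiguous relation divided by \<open>N\<close>.\<close>
  have vM: "v * M / N = v + (q + b) - q / r"
    using ctg pos by (simp add: r_def field_simps)
  show ?thesis unfolding D_def[symmetric] N_def[symmetric] M_def[symmetric]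
  proof (cases "v * r \<le> q")
    case True
    have "2 * (v * M / N) - v * r = 2 * (v - q / r) + 2 * (q + b) - v * r" by (simp add: vM)
    \<comment> \<open>The left-hand side is \<open>(v r - q) / r\<close>; its numerator is
      nonpositive and \<open>r < 1\<close>, so the division only decreases it.\<close>
    moreover have "v - q / r \<le> v * r - q"
    proof -
      have "(v * r - q) / r \<le> (v * r - q) / 1"
        using True r by (intro divide_left_mono_neg) auto
      thus ?thesis using r by (simp add: diff_divide_distrib)
    qed
    ultimately have "2 * (v * M / N) - v * r \<le> q + 2 * b"
      using True by argo
    \<comment> \<open>Cleared of denominators this is \<open>(q + b) (b + 2) <= 3 (q + 1)\<close>,
      which holds factor by factor because \<open>b < 1\<close>.\<close>
    also have "q + 2 * b \<le> 6 * (q + 1) / (b + 2) - q"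
    proof -
      have "(2 * q + 2 * b) * (b + 2) \<le> (2 * q + 2) * 3"
        using b q by (intro mult_mono) auto
      thus ?thesis using b by (simp add: field_simps)
    qed
    finally show "2 * (v * M / N) - v * N / D \<le> P" using P by (simp add: r_def)
  next
    case False
    \<comment> \<open>Here the subtracted term \<open>v r\<close> exceeds \<open>q\<close>, which
      accounts for the \<open>- q\<close> in the lower bound on \<open>P\<close>.\<close>
    have "(b + 2) * (v * M) \<le> 3 * (q + 1) * N"
      unfolding M_def N_def by (rule beta_exp_ratio_bound[OF b q Psi v])
    hence "2 * (v * M / N) \<le> 6 * (q + 1) / (b + 2)"
      using pos b by (simp add: field_simps)
    thus "2 * (v * M / N) - v * N / D \<le> P" using P False by (simp add: r_def)
  qed
qed

section \<open>Normal densities and the minimax risk\<close>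

lemma borel_measurable_vec_nth [measurable (raw)]:
  fixes f :: "'a \<Rightarrow> real ^ 'n"
  assumes "f \<in> borel_measurable M"
  shows "(\<lambda>x. f x $ i) \<in> borel_measurable M"
  using assms by (simp add: cart_eq_inner_axis)

lemma borel_measurable_mvn_density [measurable (raw)]:
  fixes f g :: "'a \<Rightarrow> real ^ 'n"
  assumes [measurable]: "f \<in> borel_measurable M" "h \<in> borel_measurable M" "g \<in> borel_measurable M"
  shows "(\<lambda>x. mvn_density (f x) (h x) (g x)) \<in> borel_measurable M"
  unfolding mvn_density_def normal_density_def by measurable

lemma mvn_density_nonneg [simp]: "0 \<le> mvn_density \<mu> v x"
  unfolding mvn_density_def by (intro prod_nonneg) auto

lemma power2_norm_vec: "(norm (x :: real ^ 'n))\<^sup>2 = (\<Sum>i\<in>UNIV. (x $ i)\<^sup>2)"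
  unfolding power2_norm_eq_inner inner_vec_def by (simp add: power2_eq_square)

lemma mvn_density_exp:
  fixes x \<mu> :: "real ^ 'n"
  assumes "0 < v"
  shows "mvn_density \<mu> v x = (1 / sqrt (2 * pi * v)) ^ CARD('n) * exp (- (norm (x - \<mu>))\<^sup>2 / (2 * v))"
proof -
  have "mvn_density \<mu> v x = (\<Prod>i\<in>(UNIV :: 'n set). (1 / sqrt (2 * pi * v)) * exp (- ((x - \<mu>) $ i)\<^sup>2 / (2 * v)))"
    using assms by (simp add: mvn_density_def normal_density_def)
  also have "\<dots> = (1 / sqrt (2 * pi * v)) ^ CARD('n) * exp (\<Sum>i\<in>(UNIV :: 'n set). - ((x - \<mu>) $ i)\<^sup>2 / (2 * v))"
    unfolding prod.distrib by (simp add: exp_sum)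
  also have "(\<Sum>i\<in>(UNIV :: 'n set). - ((x - \<mu>) $ i)\<^sup>2 / (2 * v)) = - (norm (x - \<mu>))\<^sup>2 / (2 * v)"
    unfolding power2_norm_vec by (simp add: sum_negf sum_divide_distrib)
  finally show ?thesis .
qed

text \<open>Tonelli's product formula, carried over from basis vectors to coordinates by the
  bijection sending \<open>i\<close> to \<open>axis i 1\<close>.\<close>

lemma nn_integral_lborel_vec_prod:
  fixes f :: "'n::finite \<Rightarrow> real \<Rightarrow> ennreal"
  assumes [measurable]: "\<And>i. f i \<in> borel_measurable borel"
  shows "(\<integral>\<^sup>+x. (\<Prod>i\<in>UNIV. f i ((x :: real ^ 'n) $ i)) \<partial>lborel) = (\<Prod>i\<in>UNIV. (\<integral>\<^sup>+x. f i x \<partial>lborel))"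
proof -
  define ax where "ax = (\<lambda>i::'n. axis i (1::real))"
  have inj: "inj ax" by (auto simp: ax_def inj_on_def axis_eq_axis)
  have Basis: "(Basis :: (real ^ 'n) set) = range ax"
    by (auto simp: Basis_vec_def ax_def)
  define g where "g b = f (inv ax b)" for b
  have g: "g (ax i) = f i" for i using inj by (simp add: g_def)
  have "(\<integral>\<^sup>+x. (\<Prod>b\<in>Basis. g b ((x :: real ^ 'n) \<bullet> b)) \<partial>lborel) = (\<Prod>b\<in>(Basis :: (real ^ 'n) set). (\<integral>\<^sup>+x. g b x \<partial>lborel))"
    by (rule nn_integral_lborel_prod) (auto simp: g_def)
  thus ?thesis
    unfolding Basis by (simp add: prod.reindex[OF inj] g) (simp add: ax_def cart_eq_inner_axis)
qed

text \<open>Squared bias plus variance: expand \<open>d - x\<close> about the mean; the linear term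
  vanishes as an odd central moment.\<close>

lemma has_bochner_integral_normal_sq:
  assumes "0 < \<sigma>"
  shows "has_bochner_integral lborel (\<lambda>x. (d - x)\<^sup>2 * normal_density \<mu> \<sigma> x) ((d - \<mu>)\<^sup>2 + \<sigma>\<^sup>2)"
proof -
  have 0: "has_bochner_integral lborel (\<lambda>x. (d - \<mu>)\<^sup>2 * normal_density \<mu> \<sigma> x) ((d - \<mu>)\<^sup>2 * 1)"
    using assms by (intro has_bochner_integral_mult_right) (simp add: has_bochner_integral_iff)
  have 1: "has_bochner_integral lborel (\<lambda>x. (- 2 * (d - \<mu>)) * (normal_density \<mu> \<sigma> x * (x - \<mu>))) ((- 2 * (d - \<mu>)) * 0)"
    using normal_moment_odd[OF assms, of \<mu> 0] by (intro has_bochner_integral_mult_right) simp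
  have 2: "has_bochner_integral lborel (\<lambda>x. normal_density \<mu> \<sigma> x * (x - \<mu>)\<^sup>2) (\<sigma>\<^sup>2)"
    using normal_moment_even[OF assms, of \<mu> 1] by simp
  have eq: "(\<lambda>x. (d - \<mu>)\<^sup>2 * normal_density \<mu> \<sigma> x + (- 2 * (d - \<mu>)) * (normal_density \<mu> \<sigma> x * (x - \<mu>)) + normal_density \<mu> \<sigma> x * (x - \<mu>)\<^sup>2)
     = (\<lambda>x. (d - x)\<^sup>2 * normal_density \<mu> \<sigma> x)"
    by (rule ext) (simp add: algebra_simps power2_eq_square)
  show ?thesis
    using has_bochner_integral_add[OF has_bochner_integral_add[OF 0 1] 2] unfolding eq by simp
qed

lemma nn_integral_normal_density: "0 < \<sigma> \<Longrightarrow> (\<integral>\<^sup>+x. normal_density \<mu> \<sigma> x \<partial>lborel) = 1"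
  by (subst nn_integral_eq_integral) auto

lemma nn_integral_normal_sq:
  assumes "0 < \<sigma>"
  shows "(\<integral>\<^sup>+x. (d - x)\<^sup>2 * normal_density \<mu> \<sigma> x \<partial>lborel) = ennreal ((d - \<mu>)\<^sup>2 + \<sigma>\<^sup>2)"
  using has_bochner_integral_normal_sq[OF assms, of d \<mu>]
  by (subst nn_integral_eq_integral) (auto simp: has_bochner_integral_iff)

lemma nn_integral_mvn_density:
  fixes \<mu> :: "real ^ 'n"
  assumes "0 < v"
  shows "(\<integral>\<^sup>+x. mvn_density \<mu> v x \<partial>lborel) = 1"
proof -
  have "(\<integral>\<^sup>+x. mvn_density \<mu> v x \<partial>lborel) = (\<integral>\<^sup>+x. (\<Prod>i\<in>UNIV. ennreal (normal_density (\<mu> $ i) (sqrt v) (x $ i))) \<partial>lborel)"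
    unfolding mvn_density_def by (simp add: prod_ennreal)
  also have "\<dots> = 1"
    using assms by (subst nn_integral_lborel_vec_prod) (auto simp: nn_integral_normal_density)
  finally show ?thesis .
qed

text \<open>The squared norm is a sum over coordinates. Each summand is a product integral in which
  one factor is a second moment and all others are 1.\<close>

lemma nn_integral_mvn_density_sq:
  fixes d \<mu> :: "real ^ 'n"
  assumes "0 < v"
  shows "(\<integral>\<^sup>+x. (norm (d - x))\<^sup>2 * mvn_density \<mu> v x \<partial>lborel) = ennreal ((norm (d - \<mu>))\<^sup>2 + real CARD('n) * v)"
proof -
  have "(\<integral>\<^sup>+x. (norm (d - x))\<^sup>2 * mvn_density \<mu> v x \<partial>lborel)
     = (\<integral>\<^sup>+x. (\<Sum>i\<in>UNIV. \<Prod>j\<in>UNIV. ennreal ((if j = i then (d $ j - x $ j)\<^sup>2 else 1) * normal_density (\<mu> $ j) (sqrt v) (x $ j))) \<partial>lborel)"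
  proof (rule nn_integral_cong)
    fix x :: "real ^ 'n"
    have "(norm (d - x))\<^sup>2 * mvn_density \<mu> v x
       = (\<Sum>i\<in>UNIV. (\<Prod>j\<in>UNIV. if j = i then (d $ j - x $ j)\<^sup>2 else 1) * (\<Prod>j\<in>UNIV. normal_density (\<mu> $ j) (sqrt v) (x $ j)))"
      unfolding power2_norm_vec mvn_density_def sum_distrib_right by simp
    also have "\<dots> = (\<Sum>i\<in>UNIV. \<Prod>j\<in>UNIV. (if j = i then (d $ j - x $ j)\<^sup>2 else 1) * normal_density (\<mu> $ j) (sqrt v) (x $ j))"
      unfolding prod.distrib ..
    finally show "ennreal ((norm (d - x))\<^sup>2 * mvn_density \<mu> v x) =
       (\<Sum>i\<in>UNIV. \<Prod>j\<in>UNIV. ennreal ((if j = i then (d $ j - x $ j)\<^sup>2 else 1) * normal_density (\<mu> $ j) (sqrt v) (x $ j)))"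
      by (simp add: prod_ennreal sum_ennreal prod_nonneg)
  qed
  also have "\<dots> = (\<Sum>i\<in>UNIV. \<Prod>j\<in>UNIV. (\<integral>\<^sup>+x. ennreal ((if j = i then (d $ j - x)\<^sup>2 else 1) * normal_density (\<mu> $ j) (sqrt v) x) \<partial>lborel))"
    by (subst nn_integral_sum, measurable)
       (intro sum.cong refl nn_integral_lborel_vec_prod, measurable)
  also have "\<dots> = (\<Sum>i\<in>UNIV. \<Prod>j\<in>UNIV. (if j = i then ennreal ((d $ j - \<mu> $ j)\<^sup>2 + v) else 1))"
    using assms by (intro sum.cong prod.cong refl)
      (auto simp: nn_integral_normal_sq nn_integral_normal_density)
  also have "\<dots> = (\<Sum>i\<in>UNIV. ennreal ((d $ i - \<mu> $ i)\<^sup>2 + v))"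
    by simp
  also have "\<dots> = ennreal (\<Sum>i\<in>UNIV. (d $ i - \<mu> $ i)\<^sup>2 + v)"
    using assms by (intro sum_ennreal) auto
  also have "\<dots> = ennreal ((norm (d - \<mu>))\<^sup>2 + real CARD('n) * v)"
    by (simp add: power2_norm_vec sum.distrib)
  finally show ?thesis .
qed

text \<open>Completing the square in \<beta> factors the joint density into the marginal of
  \<open>y\<close>, of variance \<open>1 + t\<close>, and the posterior of \<beta>, with mean
  \<open>t / (1 + t) * y\<close> and variance \<open>t / (1 + t)\<close>.\<close>

lemma normal_density_conjugate:
  assumes "0 < t"
  shows "normal_density \<beta> 1 y * normal_density 0 (sqrt t) \<beta> =
         normal_density 0 (sqrt (1 + t)) y * normal_density (t / (1 + t) * y) (sqrt (t / (1 + t))) \<beta>"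
proof -
  have e: "- (y - \<beta>)\<^sup>2 / 2 + - \<beta>\<^sup>2 / (2 * t) = - y\<^sup>2 / (2 * (1 + t)) + - (\<beta> - t / (1 + t) * y)\<^sup>2 / (2 * (t / (1 + t)))"
  proof -
    have "t \<noteq> 0" "1 + t \<noteq> 0" using assms by auto
    thus ?thesis by (simp add: divide_simps) algebra
  qed
  have c: "sqrt (2 * pi) * sqrt (2 * pi * t) = sqrt (2 * pi * (1 + t)) * sqrt (2 * pi * (t / (1 + t)))"
    using assms by (simp flip: real_sqrt_mult)
  have "normal_density \<beta> 1 y * normal_density 0 (sqrt t) \<beta> = 
      1 / (sqrt (2 * pi) * sqrt (2 * pi * t)) * exp (- (y - \<beta>)\<^sup>2 / 2 + - \<beta>\<^sup>2 / (2 * t))"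
    unfolding exp_add using assms by (simp add: normal_density_def)
  also have "\<dots> = normal_density 0 (sqrt (1 + t)) y * normal_density (t / (1 + t) * y) (sqrt (t / (1 + t))) \<beta>"
    unfolding e c exp_add using assms by (simp add: normal_density_def)
  finally show ?thesis .
qed

lemma mvn_density_conjugate:
  assumes "0 < t"
  shows "mvn_density \<beta> 1 y * mvn_density 0 t \<beta> =
         mvn_density 0 (1 + t) y * mvn_density ((t / (1 + t)) *\<^sub>R y) (t / (1 + t)) \<beta>"
  unfolding mvn_density_def prod.distrib[symmetric]
  using normal_density_conjugate[OF assms] by simp

section \<open>Lower bound for the maximal risk\<close>

lemma risk_altdef:
  fixes \<delta> :: "real ^ 'n \<Rightarrow> real ^ 'n"
  assumes [measurable]: "\<delta> \<in> borel_measurable borel"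
  shows "risk \<beta> \<delta> = (\<integral>\<^sup>+y. ennreal ((norm (\<delta> y - \<beta>))\<^sup>2) * ennreal (mvn_density \<beta> 1 y) \<partial>lborel)"
  unfolding risk_def mvn_def by (subst nn_integral_density) (auto simp: mult.commute)

text \<open>The maximal risk is at least the risk averaged over the prior \<open>N(0, t I)\<close>,
  which is at least the Bayes risk, the trace of the posterior covariance.\<close>

lemma Sup_risk_ge_bayes_risk:
  fixes \<delta> :: "real ^ 'n \<Rightarrow> real ^ 'n"
  assumes [measurable]: "\<delta> \<in> borel_measurable borel" and t: "0 < t"
  shows "ennreal (real CARD('n) * (t / (1 + t))) \<le> (SUP \<beta>. risk \<beta> \<delta>)"
proof -
  define s where "s = t / (1 + t)"
  have s: "s > 0" using t by (simp add: s_def)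
  have conj: "mvn_density (s *\<^sub>R y) s \<beta> * mvn_density 0 (1 + t) y = mvn_density \<beta> 1 y * mvn_density 0 t \<beta>"
    for y \<beta> :: "real ^ 'n"
    unfolding s_def mvn_density_conjugate[OF t] by (rule mult.commute)
  have "ennreal (real CARD('n) * s) = (\<integral>\<^sup>+y. ennreal (real CARD('n) * s) * mvn_density (0 :: real ^ 'n) (1 + t) y \<partial>lborel)"
    using t by (subst nn_integral_cmult) (auto simp: nn_integral_mvn_density)
  \<comment> \<open>Adding the squared distance to the posterior mean gives the posterior expected
    loss of \<open>\<delta> y\<close>.\<close>
  also have "\<dots> \<le> (\<integral>\<^sup>+y. ennreal ((norm (\<delta> y - s *\<^sub>R y))\<^sup>2 + real CARD('n) * s) * mvn_density 0 (1 + t) y \<partial>lborel)"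
    using s by (intro nn_integral_mono mult_right_mono ennreal_leI) auto
  also have "\<dots> = (\<integral>\<^sup>+y. (\<integral>\<^sup>+\<beta>. ennreal ((norm (\<delta> y - \<beta>))\<^sup>2 * mvn_density (s *\<^sub>R y) s \<beta>) * mvn_density 0 (1 + t) y \<partial>lborel) \<partial>lborel)"
    by (intro nn_integral_cong) (simp add: nn_integral_mvn_density_sq[OF s, symmetric] nn_integral_multc)
  also have "\<dots> = (\<integral>\<^sup>+y. (\<integral>\<^sup>+\<beta>. ennreal ((norm (\<delta> y - \<beta>))\<^sup>2) * ennreal (mvn_density \<beta> 1 y) * ennreal (mvn_density 0 t \<beta>) \<partial>lborel) \<partial>lborel)"
    by (intro nn_integral_cong) (simp add: ennreal_mult[symmetric] mult.assoc conj)
  also have "\<dots> = (\<integral>\<^sup>+\<beta>. (\<integral>\<^sup>+y. ennreal ((norm (\<delta> y - \<beta>))\<^sup>2) * ennreal (mvn_density \<beta> 1 y) * ennreal (mvn_density 0 t \<beta>) \<partial>lborel) \<partial>lborel)"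
    by (rule lborel_pair.Fubini') measurable
  also have "\<dots> = (\<integral>\<^sup>+\<beta>. risk \<beta> \<delta> * ennreal (mvn_density 0 t \<beta>) \<partial>lborel)"
    by (intro nn_integral_cong) (simp add: nn_integral_multc risk_altdef)
  also have "\<dots> \<le> (\<integral>\<^sup>+\<beta>. (SUP \<beta>. risk \<beta> \<delta>) * ennreal (mvn_density 0 t (\<beta> :: real ^ 'n)) \<partial>lborel)"
    by (intro nn_integral_mono mult_right_mono SUP_upper) auto
  also have "\<dots> = (SUP \<beta>. risk \<beta> \<delta>)"
    using t by (subst nn_integral_cmult) (auto simp: nn_integral_mvn_density)
  finally show ?thesis by (simp add: s_def)
qed

text \<open>The Bayes risks tend to \<open>CARD('n)\<close> along the prior variances
  \<open>t = Suc n\<close>, which are positive.\<close>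

lemma Sup_risk_ge:
  fixes \<delta> :: "real ^ 'n \<Rightarrow> real ^ 'n"
  assumes "\<delta> \<in> borel_measurable borel"
  shows "ennreal (real CARD('n)) \<le> (SUP \<beta>. risk \<beta> \<delta>)"
proof (rule LIMSEQ_le_const2)
  have "(\<lambda>n. real CARD('n) * (real (Suc n) / (1 + real (Suc n)))) \<longlonglongrightarrow> real CARD('n) * 1"
    by (intro tendsto_mult tendsto_const) real_asymp
  thus "(\<lambda>n. ennreal (real CARD('n) * (real (Suc n) / (1 + real (Suc n))))) \<longlonglongrightarrow> ennreal (real CARD('n))"
    by (intro tendsto_ennrealI) simp
  show "\<exists>N. \<forall>n\<ge>N. ennreal (real CARD('n) * (real (Suc n) / (1 + real (Suc n)))) \<le> (SUP \<beta>. risk \<beta> \<delta>)"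
    using Sup_risk_ge_bayes_risk[OF assms] by (auto simp del: of_nat_Suc)
qed

text \<open>No estimator has maximal risk below \<open>CARD('n)\<close>, so one that never exceeds
  this value attains the infimum.\<close>

lemma minimaxI:
  fixes \<delta> :: "real ^ 'n \<Rightarrow> real ^ 'n"
  assumes "\<delta> \<in> borel_measurable borel" "\<And>\<beta>. risk \<beta> \<delta> \<le> ennreal (real CARD('n))"
  shows "minimax \<delta>"
proof -
  have "(SUP \<beta>. risk \<beta> \<delta>) \<le> (INF (\<delta>' :: real ^ 'n \<Rightarrow> real ^ 'n) \<in> borel_measurable borel. SUP \<beta>. risk \<beta> \<delta>')"
    using assms(2) by (intro INF_greatest order_trans[OF SUP_least Sup_risk_ge]) auto
  moreover have "(INF (\<delta>' :: real ^ 'n \<Rightarrow> real ^ 'n) \<in> borel_measurable borel. SUP \<beta>. risk \<beta> \<delta>') \<le> (SUP \<beta>. risk \<beta> \<delta>)"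
    by (intro INF_lower assms(1))
  ultimately show ?thesis unfolding minimax_def using assms(1) by auto
qed

section \<open>Stein's identity\<close>

lemma integrable_lborel_translation:
  fixes f :: "'a :: euclidean_space \<Rightarrow> real"
  assumes "integrable lborel f"
  shows "integrable lborel (\<lambda>x. f (c + x))"
proof -
  have "integrable (distr lborel borel ((+) c)) f" using assms by (simp add: lborel_distr_plus)
  thus ?thesis by (subst (asm) integrable_distr_eq) (use assms in auto)
qed

lemma integral_lborel_translation:
  fixes f :: "'a :: euclidean_space \<Rightarrow> real"
  assumes [measurable]: "f \<in> borel_measurable borel"
  shows "(\<integral>x. f (c + x) \<partial>lborel) = (\<integral>x. f x \<partial>lborel)"
proof -
  have "(\<integral>x. f x \<partial>lborel) = (\<integral>x. f x \<partial>distr lborel borel ((+) c))" by (simp add: lborel_distr_plus)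
  also have "\<dots> = (\<integral>x. f (c + x) \<partial>lborel)" by (subst integral_distr) auto
  finally show ?thesis ..
qed

text \<open>Integrating \<open>f (x + u) - f x\<close> over \<open>x\<close> gives 0 by translation invariance; writing it as
  an integral of \<open>g\<close> over a segment and exchanging the integrals gives the integral of \<open>g\<close>.\<close>

lemma integral_directional_derivative_eq_0:
  fixes f g :: "'a :: euclidean_space \<Rightarrow> real"
  assumes deriv: "\<And>x s. ((\<lambda>s. f (x + s *\<^sub>R u)) has_real_derivative g (x + s *\<^sub>R u)) (at s)"
    and f: "integrable lborel f" and g: "integrable lborel g" and cont: "continuous_on UNIV g"
  shows "(\<integral>x. g x \<partial>lborel) = 0"
proof -
  have [measurable]: "f \<in> borel_measurable borel" "g \<in> borel_measurable borel"
    using f g by auto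
  define k where "k s x = indicator {0..1} s * g (s *\<^sub>R u + x)" for s :: real and x
  have [measurable]: "case_prod k \<in> borel_measurable (lborel \<Otimes>\<^sub>M lborel)"
    unfolding k_def by measurable
  have gt: "integrable lborel (\<lambda>x. g (c + x))" for c
    by (rule integrable_lborel_translation[OF g])
  have int: "integrable (lborel \<Otimes>\<^sub>M lborel) (case_prod k)"
  proof (rule lborel_pair.Fubini_integrable)
    \<comment> \<open>By translation invariance the inner integral does not depend on
      \<open>s\<close> within \<open>{0..1}\<close>, which yields joint integrability.\<close>
    have "(\<integral>x. norm (k s x) \<partial>lborel) = indicator {0..1} s * (\<integral>x. norm (g x) \<partial>lborel)" for s
    proof -
      have "(\<integral>x. norm (k s x) \<partial>lborel) = (\<integral>x. indicator {0..1} s * norm (g (s *\<^sub>R u + x)) \<partial>lborel)"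
        by (simp add: k_def abs_mult)
      also have "\<dots> = indicator {0..1} s * (\<integral>x. norm (g x) \<partial>lborel)"
        using integral_lborel_translation[of "\<lambda>x. norm (g x)" "s *\<^sub>R u"] by simp
      finally show ?thesis .
    qed
    thus "integrable lborel (\<lambda>s. \<integral>x. norm (case (s, x) of (s, x) \<Rightarrow> k s x) \<partial>lborel)"
      by simp
    show "AE s in lborel. integrable lborel (\<lambda>x. case (s, x) of (s, x) \<Rightarrow> k s x)"
      using gt by (simp add: k_def)
  qed measurable
  have "(\<integral>x. (\<integral>s. k s x \<partial>lborel) \<partial>lborel) = (\<integral>s. (\<integral>x. k s x \<partial>lborel) \<partial>lborel)"
    by (rule lborel_pair.Fubini_integral[OF int])
  also have "\<dots> = (\<integral>s. indicator {0..1} (s :: real) * (\<integral>x. g x \<partial>lborel) \<partial>lborel)"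
    unfolding k_def by (simp add: integral_lborel_translation)
  also have "\<dots> = (\<integral>x. g x \<partial>lborel)" by simp
  also have "(\<lambda>x. \<integral>s. k s x \<partial>lborel) = (\<lambda>x. f (u + x) - f x)"
  proof
    fix x
    have "continuous_on UNIV (\<lambda>s. g (x + s *\<^sub>R u))"
      by (rule continuous_on_compose2[OF cont]) (auto intro!: continuous_intros)
    hence "(\<integral>s. g (x + s *\<^sub>R u) * indicator {0..1} s \<partial>lborel) = f (x + 1 *\<^sub>R u) - f (x + 0 *\<^sub>R u)"
      using deriv by (intro integral_FTC_Icc_real) (auto simp: continuous_on_eq_continuous_at)
    thus "(\<integral>s. k s x \<partial>lborel) = f (u + x) - f x"
      by (simp add: k_def add.commute mult.commute)
  qed
  also have "(\<integral>x. f (u + x) - f x \<partial>lborel) = 0"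
    using integrable_lborel_translation[OF f] f by (simp add: integral_lborel_translation)
  finally show ?thesis by simp
qed

lemma has_bochner_integral_mvn_density:
  fixes \<beta> :: "real ^ 'n"
  shows "has_bochner_integral lborel (mvn_density \<beta> 1) 1"
  by (rule has_bochner_integral_nn_integral) (auto simp: nn_integral_mvn_density)

lemma has_bochner_integral_mvn_density_sq:
  fixes \<beta> :: "real ^ 'n"
  shows "has_bochner_integral lborel (\<lambda>x. (norm (x - \<beta>))\<^sup>2 * mvn_density \<beta> 1 x) (real CARD('n))"
proof (rule has_bochner_integral_nn_integral)
  have "(\<integral>\<^sup>+x. (norm (x - \<beta>))\<^sup>2 * mvn_density \<beta> 1 x \<partial>lborel) = (\<integral>\<^sup>+x. (norm (\<beta> - x))\<^sup>2 * mvn_density \<beta> 1 x \<partial>lborel)"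
    by (simp add: norm_minus_commute)
  thus "(\<integral>\<^sup>+x. (norm (x - \<beta>))\<^sup>2 * mvn_density \<beta> 1 x \<partial>lborel) = ennreal (real CARD('n))"
    by (simp only: nn_integral_mvn_density_sq[OF zero_less_one]) simp
qed auto

lemma has_derivative_norm_sq_line:
  fixes x u :: "'a :: real_inner"
  shows "((\<lambda>s. (norm (x + s *\<^sub>R u))\<^sup>2) has_real_derivative 2 * ((x + s *\<^sub>R u) \<bullet> u)) (at s)"
  unfolding power2_norm_eq_inner has_field_derivative_def
  by (rule has_derivative_eq_rhs, (rule derivative_intros)+) (auto simp: fun_eq_iff inner_commute algebra_simps)

lemma mvn_density_has_derivative_line:
  fixes x u \<beta> :: "real ^ 'n"
  shows "((\<lambda>s. mvn_density \<beta> 1 (x + s *\<^sub>R u)) has_real_derivative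
     - ((x + s *\<^sub>R u - \<beta>) \<bullet> u) * mvn_density \<beta> 1 (x + s *\<^sub>R u)) (at s)"
proof -
  have "((\<lambda>s. (norm (x - \<beta> + s *\<^sub>R u))\<^sup>2) has_real_derivative 2 * ((x - \<beta> + s *\<^sub>R u) \<bullet> u)) (at s)"
    by (rule has_derivative_norm_sq_line)
  moreover have "((\<lambda>s. C * exp (- N s / (2 * 1))) has_real_derivative - (D / 2) * (C * exp (- N s / (2 * 1)))) (at s)"
    if "(N has_real_derivative D) (at s)" for C D and N :: "real \<Rightarrow> real"
    using that by (auto intro!: derivative_eq_intros)
  ultimately have "((\<lambda>s. (1 / sqrt (2 * pi * 1)) ^ CARD('n) * exp (- (norm (x - \<beta> + s *\<^sub>R u))\<^sup>2 / (2 * 1))) has_real_derivative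
     - (2 * ((x - \<beta> + s *\<^sub>R u) \<bullet> u) / 2) * ((1 / sqrt (2 * pi * 1)) ^ CARD('n) * exp (- (norm (x - \<beta> + s *\<^sub>R u))\<^sup>2 / (2 * 1)))) (at s)"
    by blast
  thus ?thesis unfolding mvn_density_exp[OF zero_less_one] by (simp add: diff_add_eq)
qed

lemma continuous_on_mvn_density: "continuous_on UNIV (mvn_density \<beta> 1)"
  unfolding mvn_density_exp[OF zero_less_one, abs_def] by (intro continuous_intros) auto

section \<open>Shrinkage estimators with a bounded factor \<open>H\<close> of bounded
  derivative\<close>

context
  fixes H H' :: "real \<Rightarrow> real"
  assumes deriv: "\<And>v. 0 \<le> v \<Longrightarrow> (H has_real_derivative H' v) (at v)"
    and cont: "continuous_on {0..} H'"
    and H_bound: "\<And>v. 0 \<le> v \<Longrightarrow> \<bar>H v\<bar> \<le> 1"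
    and H'_bound: "\<And>v. 0 \<le> v \<Longrightarrow> \<bar>H' v\<bar> \<le> 1"
begin

text \<open>The integrand is the derivative in direction \<open>u\<close> of
  \<open>H (v x) * (x \<bullet> u) * mvn_density \<beta> 1 x\<close>. The bounds on \<open>H\<close>
  and \<open>H'\<close> make both functions integrable.\<close>

lemma stein_integrand:
  fixes \<beta> u :: "real ^ 'n"
  assumes u: "norm u = 1"
  defines "v \<equiv> \<lambda>x :: real ^ 'n. (norm x)\<^sup>2 / 2"
  shows "has_bochner_integral lborel
    (\<lambda>x. (H' (v x) * (x \<bullet> u)\<^sup>2 + H (v x) - H (v x) * ((x \<bullet> u) * ((x - \<beta>) \<bullet> u))) * mvn_density \<beta> 1 x) 0"
proof -
  define f where "f x = H (v x) * (x \<bullet> u) * mvn_density \<beta> 1 x" for x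
  define g where "g x = (H' (v x) * (x \<bullet> u)\<^sup>2 + H (v x) - H (v x) * ((x \<bullet> u) * ((x - \<beta>) \<bullet> u))) * mvn_density \<beta> 1 x" for x
  have v: "0 \<le> v x" for x by (simp add: v_def)
  have contH: "continuous_on {0..} H"
    using deriv by (intro continuous_at_imp_continuous_on) (auto intro: DERIV_isCont)
  have cv: "continuous_on UNIV v" unfolding v_def by (intro continuous_intros) auto
  have cH: "continuous_on UNIV (\<lambda>x. H (v x))" "continuous_on UNIV (\<lambda>x. H' (v x))"
    using v by (auto intro!: continuous_on_compose2[OF contH cv] continuous_on_compose2[OF cont cv])
  have contf: "continuous_on UNIV f" unfolding f_def
    by (intro continuous_intros cH continuous_on_mvn_density)
  have contg: "continuous_on UNIV g" unfolding g_def
    by (intro continuous_intros cH continuous_on_mvn_density)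
  \<comment> \<open>The three summands of \<open>g\<close> are bounded by \<open>|x|^2\<close>, 1
    and \<open>|x|^2 + |x - \<beta>|^2\<close>; with
    \<open>|x|^2 <= 2 |x - \<beta>|^2 + 2 |\<beta>|^2\<close> these add up to the constants 5, 4 and
    1.\<close>
  define m where "m x = (5 * (norm (x - \<beta>))\<^sup>2 + (4 * (norm \<beta>)\<^sup>2 + 1)) * mvn_density \<beta> 1 x" for x
  have m: "integrable lborel m"
    unfolding m_def distrib_right
    using has_bochner_integral_mvn_density_sq[of \<beta>] has_bochner_integral_mvn_density[of \<beta>]
    by (auto simp: mult.assoc has_bochner_integral_iff)
  have xu: "\<bar>x \<bullet> u\<bar> \<le> norm x" for x :: "real ^ 'n"
    using Cauchy_Schwarz_ineq2[of x u] u by simp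
  have nx: "(norm x)\<^sup>2 \<le> 2 * (norm (x - \<beta>))\<^sup>2 + 2 * (norm \<beta>)\<^sup>2" for x
  proof -
    have "norm x \<le> norm (x - \<beta>) + norm \<beta>" using norm_triangle_ineq[of "x - \<beta>" \<beta>] by simp
    hence "(norm x)\<^sup>2 \<le> (norm (x - \<beta>) + norm \<beta>)\<^sup>2" by (intro power_mono) auto
    also have "\<dots> \<le> 2 * (norm (x - \<beta>))\<^sup>2 + 2 * (norm \<beta>)\<^sup>2"
      using zero_le_power2[of "norm (x - \<beta>) - norm \<beta>"] by (simp add: power2_eq_square algebra_simps)
    finally show ?thesis .
  qed
  have fm: "norm (f x) \<le> norm (m x)" for x
  proof -
    have "\<bar>H (v x) * (x \<bullet> u)\<bar> \<le> 1 * norm x"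
      unfolding abs_mult by (intro mult_mono H_bound v xu) auto
    also have "\<dots> \<le> (norm x)\<^sup>2 + 1"
      using zero_le_power2[of "norm x - 1/2"] by (simp add: power2_eq_square algebra_simps)
    also have "\<dots> \<le> 5 * (norm (x - \<beta>))\<^sup>2 + (4 * (norm \<beta>)\<^sup>2 + 1)"
      using nx[of x] zero_le_power2[of "norm (x - \<beta>)"] zero_le_power2[of "norm \<beta>"] by linarith
    finally show ?thesis unfolding f_def m_def real_norm_def abs_mult[of _ "mvn_density \<beta> 1 x"]
      by (intro mult_right_mono) auto
  qed
  have gm: "norm (g x) \<le> norm (m x)" for x
  proof -
    have 1: "\<bar>H' (v x) * (x \<bullet> u)\<^sup>2\<bar> \<le> 1 * (norm x)\<^sup>2"
      unfolding abs_mult using xu[of x]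
      by (intro mult_mono H'_bound v) (auto simp: abs_le_square_iff[symmetric])
    have 2: "\<bar>H (v x) * ((x \<bullet> u) * ((x - \<beta>) \<bullet> u))\<bar> \<le> 1 * (norm x * norm (x - \<beta>))"
      unfolding abs_mult by (intro mult_mono H_bound v xu) auto
    have 3: "norm x * norm (x - \<beta>) \<le> (norm x)\<^sup>2 + (norm (x - \<beta>))\<^sup>2"
      using zero_le_power2[of "norm x - norm (x - \<beta>)"] zero_le_power2[of "norm x"] zero_le_power2[of "norm (x - \<beta>)"]
      unfolding power2_diff by linarith
    have "\<bar>H' (v x) * (x \<bullet> u)\<^sup>2 + H (v x) - H (v x) * ((x \<bullet> u) * ((x - \<beta>) \<bullet> u))\<bar>
       \<le> 5 * (norm (x - \<beta>))\<^sup>2 + (4 * (norm \<beta>)\<^sup>2 + 1)"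
      using 1 2 3 H_bound[OF v[of x]] nx[of x] by linarith
    thus ?thesis unfolding g_def m_def real_norm_def abs_mult[of _ "mvn_density \<beta> 1 x"]
      by (intro mult_right_mono) auto
  qed
  have f: "integrable lborel f"
    by (rule Bochner_Integration.integrable_bound[OF m])
       (use fm contf in \<open>auto intro: borel_measurable_continuous_onI\<close>)
  have g: "integrable lborel g"
    by (rule Bochner_Integration.integrable_bound[OF m])
       (use gm contg in \<open>auto intro: borel_measurable_continuous_onI\<close>)
  have "(\<integral>x. g x \<partial>lborel) = 0"
  proof (rule integral_directional_derivative_eq_0[OF _ f g contg])
    fix x s
    define y where "y = x + s *\<^sub>R u"
    have dv: "((\<lambda>s. v (x + s *\<^sub>R u)) has_real_derivative (y \<bullet> u)) (at s)"
      unfolding v_def y_def using DERIV_cdivide[OF has_derivative_norm_sq_line[of x u s], of 2] by simp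
    have dH: "((\<lambda>s. H (v (x + s *\<^sub>R u))) has_real_derivative H' (v y) * (y \<bullet> u)) (at s)"
      using DERIV_chain2[OF deriv[OF v] dv] by (simp add: y_def)
    have di: "((\<lambda>s. (x + s *\<^sub>R u) \<bullet> u) has_real_derivative 1) (at s)"
      using u by (auto intro!: derivative_eq_intros simp: inner_add_left norm_eq_1)
    have "((\<lambda>s. f (x + s *\<^sub>R u)) has_real_derivative
        (H' (v y) * (y \<bullet> u) * (y \<bullet> u) + 1 * H (v y)) * mvn_density \<beta> 1 y
         + - ((y - \<beta>) \<bullet> u) * mvn_density \<beta> 1 y * (H (v y) * (y \<bullet> u))) (at s)"
      unfolding f_def using DERIV_mult[OF DERIV_mult[OF dH di] mvn_density_has_derivative_line]
      by (simp add: y_def)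
    also have "(H' (v y) * (y \<bullet> u) * (y \<bullet> u) + 1 * H (v y)) * mvn_density \<beta> 1 y
         + - ((y - \<beta>) \<bullet> u) * mvn_density \<beta> 1 y * (H (v y) * (y \<bullet> u)) = g y"
      by (simp add: g_def power2_eq_square algebra_simps)
    finally show "((\<lambda>s. f (x + s *\<^sub>R u)) has_real_derivative g (x + s *\<^sub>R u)) (at s)"
      by (simp add: y_def)
  qed
  thus ?thesis using g unfolding g_def[abs_def] by (simp add: has_bochner_integral_iff)
qed

text \<open>Sum the directional identities over an orthonormal basis; Parseval produces the norm and
  the inner product.\<close>

lemma stein_identity:
  fixes \<beta> :: "real ^ 'n"
  defines "v \<equiv> \<lambda>x :: real ^ 'n. (norm x)\<^sup>2 / 2"
  shows "has_bochner_integral lborel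
    (\<lambda>x. (H' (v x) * (norm x)\<^sup>2 + real CARD('n) * H (v x) - H (v x) * (x \<bullet> (x - \<beta>))) * mvn_density \<beta> 1 x) 0"
proof -
  have "has_bochner_integral lborel (\<lambda>x. \<Sum>u\<in>Basis.
     (H' (v x) * (x \<bullet> u)\<^sup>2 + H (v x) - H (v x) * ((x \<bullet> u) * ((x - \<beta>) \<bullet> u))) * mvn_density \<beta> 1 x)
      (\<Sum>u\<in>(Basis :: (real ^ 'n) set). 0)"
    unfolding v_def by (intro has_bochner_integral_sum stein_integrand) auto
  also have "(\<lambda>x. \<Sum>u\<in>Basis.
     (H' (v x) * (x \<bullet> u)\<^sup>2 + H (v x) - H (v x) * ((x \<bullet> u) * ((x - \<beta>) \<bullet> u))) * mvn_density \<beta> 1 x) = 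
    (\<lambda>x. (H' (v x) * (norm x)\<^sup>2 + real CARD('n) * H (v x) - H (v x) * (x \<bullet> (x - \<beta>))) * mvn_density \<beta> 1 x)"
  proof
    fix x :: "real ^ 'n"
    have n: "(norm x)\<^sup>2 = (\<Sum>u\<in>Basis. (x \<bullet> u)\<^sup>2)"
      unfolding power2_norm_eq_inner by (subst euclidean_inner) (simp add: power2_eq_square)
    have i: "x \<bullet> (x - \<beta>) = (\<Sum>u\<in>Basis. (x \<bullet> u) * ((x - \<beta>) \<bullet> u))"
      by (rule euclidean_inner)
    show "(\<Sum>u\<in>Basis.
     (H' (v x) * (x \<bullet> u)\<^sup>2 + H (v x) - H (v x) * ((x \<bullet> u) * ((x - \<beta>) \<bullet> u))) * mvn_density \<beta> 1 x) =
     (H' (v x) * (norm x)\<^sup>2 + real CARD('n) * H (v x) - H (v x) * (x \<bullet> (x - \<beta>))) * mvn_density \<beta> 1 x"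
      unfolding n i sum_distrib_right[symmetric] by (simp add: sum.distrib sum_subtractf sum_distrib_left)
  qed
  finally show ?thesis by simp
qed

text \<open>In the expanded loss, Stein's identity trades the cross term
  \<open>H y \<bullet> (y - \<beta>)\<close> for terms free of \<beta>. With
  \<open>|y|^2 = 2 v\<close> the assumed inequality says that the resulting correction to the risk
  \<open>CARD('n)\<close> of the identity is pointwise nonpositive.\<close>

lemma minimax_shrinkage:
  assumes ineq: "\<And>v. 0 \<le> v \<Longrightarrow> 2 * v * (H v)\<^sup>2 \<le> 2 * real CARD('n) * H v + 4 * v * H' v"
  shows "minimax (\<lambda>y :: real ^ 'n. (1 - H ((norm y)\<^sup>2 / 2)) *\<^sub>R y)"
proof (rule minimaxI)
  let ?\<delta> = "\<lambda>y :: real ^ 'n. (1 - H ((norm y)\<^sup>2 / 2)) *\<^sub>R y"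
  have contH: "continuous_on {0..} H"
    using deriv by (intro continuous_at_imp_continuous_on) (auto intro: DERIV_isCont)
  have cH: "continuous_on UNIV (\<lambda>y :: real ^ 'n. H ((norm y)\<^sup>2 / 2))"
    by (rule continuous_on_compose2[OF contH]) (auto intro!: continuous_intros)
  show meas: "?\<delta> \<in> borel_measurable borel"
    by (intro borel_measurable_continuous_onI continuous_intros cH)
  fix \<beta> :: "real ^ 'n"
  define G where "G y = (H' ((norm y)\<^sup>2 / 2) * (norm y)\<^sup>2 + real CARD('n) * H ((norm y)\<^sup>2 / 2)
     - H ((norm y)\<^sup>2 / 2) * (y \<bullet> (y - \<beta>))) * mvn_density \<beta> 1 y" for y
  \<comment> \<open>Since \<open>G\<close> integrates to 0, adding \<open>2 * G\<close> leaves the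
    risk of the identity estimator unchanged.\<close>
  have bi: "has_bochner_integral lborel (\<lambda>y. (norm (y - \<beta>))\<^sup>2 * mvn_density \<beta> 1 y + 2 * G y) (real CARD('n) + 2 * 0)"
    unfolding G_def
    by (intro has_bochner_integral_add has_bochner_integral_mult_right has_bochner_integral_mvn_density_sq stein_identity)
  have le: "(norm (?\<delta> y - \<beta>))\<^sup>2 * mvn_density \<beta> 1 y \<le> (norm (y - \<beta>))\<^sup>2 * mvn_density \<beta> 1 y + 2 * G y" for y
  proof -
    define h h' where "h = H ((norm y)\<^sup>2 / 2)" and "h' = H' ((norm y)\<^sup>2 / 2)"
    have "?\<delta> y - \<beta> = (y - \<beta>) - h *\<^sub>R y" by (simp add: h_def algebra_simps)
    hence "(norm (?\<delta> y - \<beta>))\<^sup>2 = (norm (y - \<beta>))\<^sup>2 - 2 * h * (y \<bullet> (y - \<beta>)) + h\<^sup>2 * (norm y)\<^sup>2"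
      by (simp only: power2_norm_eq_inner) (simp add: inner_diff_left inner_diff_right inner_commute power2_eq_square algebra_simps)
    also have "\<dots> \<le> (norm (y - \<beta>))\<^sup>2 + 2 * (h' * (norm y)\<^sup>2 + real CARD('n) * h - h * (y \<bullet> (y - \<beta>)))"
      using ineq[of "(norm y)\<^sup>2 / 2"] unfolding h_def[symmetric] h'_def[symmetric] by (simp add: algebra_simps)
    finally have "(norm (?\<delta> y - \<beta>))\<^sup>2 * mvn_density \<beta> 1 y \<le> 
       ((norm (y - \<beta>))\<^sup>2 + 2 * (h' * (norm y)\<^sup>2 + real CARD('n) * h - h * (y \<bullet> (y - \<beta>)))) * mvn_density \<beta> 1 y"
      by (rule mult_right_mono) simp
    thus ?thesis by (simp only: G_def h_def h'_def distrib_right mult.assoc)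
  qed
  have "risk \<beta> ?\<delta> = (\<integral>\<^sup>+y. ennreal ((norm (?\<delta> y - \<beta>))\<^sup>2 * mvn_density \<beta> 1 y) \<partial>lborel)"
    using meas by (simp add: risk_altdef ennreal_mult)
  also have "\<dots> \<le> (\<integral>\<^sup>+y. ennreal ((norm (y - \<beta>))\<^sup>2 * mvn_density \<beta> 1 y + 2 * G y) \<partial>lborel)"
    by (intro nn_integral_mono ennreal_leI le)
  \<comment> \<open>The integrand is nonnegative because by \<open>le\<close> it dominates a squared
    norm times a density.\<close>
  also have "\<dots> = ennreal (real CARD('n))"
    using bi le order_trans[OF mult_nonneg_nonneg le]
    by (subst nn_integral_eq_integral) (auto simp: has_bochner_integral_iff)
  finally show "risk \<beta> ?\<delta> \<le> ennreal (real CARD('n))" .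
qed

end

section \<open>The hierarchical model\<close>

lemma kappa_prior_nonneg: "0 \<le> kappa_prior a b \<kappa>"
  by (simp add: kappa_prior_def)

lemma borel_measurable_kappa_prior [measurable]: "kappa_prior a b \<in> borel_measurable borel"
  unfolding kappa_prior_def[abs_def] by measurable

text \<open>Tonelli, then conjugacy with prior variance
  \<open>t = (1 - \<kappa>) / \<kappa>\<close>, for which \<open>1 + t = 1 / \<kappa>\<close> and
  \<open>t / (1 + t) = 1 - \<kappa>\<close>. Taking \<open>L\<close> to be 1 or the squared error
  gives the marginal or the numerator of the posterior loss.\<close>

lemma nn_integral_beta_prior:
  fixes y :: "real ^ 'n" and L :: "real ^ 'n \<Rightarrow> ennreal"
  assumes [measurable]: "L \<in> borel_measurable borel"
  shows "(\<integral>\<^sup>+\<beta>. L \<beta> * (ennreal (mvn_density \<beta> 1 y) * beta_prior a b \<beta>) \<partial>lborel) =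
    (\<integral>\<^sup>+\<kappa>. ennreal (kappa_prior a b \<kappa> * mvn_density 0 (1 / \<kappa>) y) *
       (\<integral>\<^sup>+\<beta>. L \<beta> * ennreal (mvn_density ((1 - \<kappa>) *\<^sub>R y) (1 - \<kappa>) \<beta>) \<partial>lborel) * indicator {0<..<1} \<kappa> \<partial>lborel)"
proof -
  have "(\<integral>\<^sup>+\<beta>. L \<beta> * (ennreal (mvn_density \<beta> 1 y) * beta_prior a b \<beta>) \<partial>lborel) =
    (\<integral>\<^sup>+\<beta>. (\<integral>\<^sup>+\<kappa>. L \<beta> * ennreal (mvn_density \<beta> 1 y) *
        (ennreal (mvn_density 0 ((1 - \<kappa>) / \<kappa>) \<beta> * kappa_prior a b \<kappa>) * indicator {0<..<1} \<kappa>) \<partial>lborel) \<partial>lborel)"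
    unfolding beta_prior_def by (intro nn_integral_cong) (simp add: nn_integral_cmult mult.assoc)
  also have "\<dots> = (\<integral>\<^sup>+\<kappa>. (\<integral>\<^sup>+\<beta>. L \<beta> * ennreal (mvn_density \<beta> 1 y) *
        (ennreal (mvn_density 0 ((1 - \<kappa>) / \<kappa>) \<beta> * kappa_prior a b \<kappa>) * indicator {0<..<1} \<kappa>) \<partial>lborel) \<partial>lborel)"
    by (rule lborel_pair.Fubini') measurable
  also have "\<dots> = (\<integral>\<^sup>+\<kappa>. (\<integral>\<^sup>+\<beta>. ennreal (kappa_prior a b \<kappa> * mvn_density 0 (1 / \<kappa>) y) *
       (L \<beta> * ennreal (mvn_density ((1 - \<kappa>) *\<^sub>R y) (1 - \<kappa>) \<beta>)) * indicator {0<..<1} \<kappa> \<partial>lborel) \<partial>lborel)"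
  proof (intro nn_integral_cong)
    fix \<kappa> :: real and \<beta> :: "real ^ 'n"
    show "L \<beta> * ennreal (mvn_density \<beta> 1 y) *
        (ennreal (mvn_density 0 ((1 - \<kappa>) / \<kappa>) \<beta> * kappa_prior a b \<kappa>) * indicator {0<..<1} \<kappa>) =
      ennreal (kappa_prior a b \<kappa> * mvn_density 0 (1 / \<kappa>) y) *
       (L \<beta> * ennreal (mvn_density ((1 - \<kappa>) *\<^sub>R y) (1 - \<kappa>) \<beta>)) * indicator {0<..<1} \<kappa>"
    proof (cases "\<kappa> \<in> {0<..<1}")
      case True
      define t where "t = (1 - \<kappa>) / \<kappa>"
      have t: "0 < t" "1 + t = 1 / \<kappa>" "t / (1 + t) = 1 - \<kappa>"
        using True by (auto simp: t_def field_simps)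
      have "mvn_density \<beta> 1 y * mvn_density 0 t \<beta> = mvn_density 0 (1 / \<kappa>) y * mvn_density ((1 - \<kappa>) *\<^sub>R y) (1 - \<kappa>) \<beta>"
        using mvn_density_conjugate[OF t(1), of \<beta> y] unfolding t(3) unfolding t(2) .
      hence "ennreal (mvn_density \<beta> 1 y) * ennreal (mvn_density 0 t \<beta>) =
          ennreal (mvn_density 0 (1 / \<kappa>) y) * ennreal (mvn_density ((1 - \<kappa>) *\<^sub>R y) (1 - \<kappa>) \<beta>)"
        by (simp add: ennreal_mult[symmetric])
      hence "L \<beta> * ennreal (kappa_prior a b \<kappa>) * (ennreal (mvn_density \<beta> 1 y) * ennreal (mvn_density 0 t \<beta>)) =
          L \<beta> * ennreal (kappa_prior a b \<kappa>) * (ennreal (mvn_density 0 (1 / \<kappa>) y) * ennreal (mvn_density ((1 - \<kappa>) *\<^sub>R y) (1 - \<kappa>) \<beta>))"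
        by simp
      thus ?thesis
        using True by (simp add: ennreal_mult kappa_prior_nonneg mult_ac t_def)
    qed simp
  qed
  also have "\<dots> = (\<integral>\<^sup>+\<kappa>. ennreal (kappa_prior a b \<kappa> * mvn_density 0 (1 / \<kappa>) y) *
       (\<integral>\<^sup>+\<beta>. L \<beta> * ennreal (mvn_density ((1 - \<kappa>) *\<^sub>R y) (1 - \<kappa>) \<beta>) \<partial>lborel) * indicator {0<..<1} \<kappa> \<partial>lborel)"
    by (intro nn_integral_cong) (simp add: nn_integral_cmult nn_integral_multc)
  finally show ?thesis .
qed

text \<open>The variance \<open>1 / \<kappa>\<close> of \<open>y\<close> in each coordinate
  contributes \<open>\<kappa> powr (p / 2)\<close> to the prior; the weight becomes the integrand in
  the denominator of \<open>beta_hat\<close>.\<close>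

lemma posterior_kernel:
  fixes y :: "real ^ 'n"
  assumes "0 < \<kappa>"
  shows "kappa_prior a b \<kappa> * mvn_density 0 (1 / \<kappa>) y = (1 / sqrt (2 * pi)) ^ CARD('n) *
    (\<kappa> powr (real CARD('n) / 2 + a - 1) * (1 - \<kappa>) powr (b - 1) * exp (- \<kappa> * ((norm y)\<^sup>2 / 2)))"
proof -
  have "(1 / sqrt (2 * pi * (1 / \<kappa>))) ^ CARD('n) = (1 / sqrt (2 * pi)) ^ CARD('n) * sqrt \<kappa> ^ CARD('n)"
    using assms by (simp add: real_sqrt_divide power_divide)
  also have "sqrt \<kappa> ^ CARD('n) = \<kappa> powr (real CARD('n) / 2)"
    using assms by (simp add: powr_half_sqrt[symmetric] powr_realpow[symmetric] powr_powr)
  finally have c: "(1 / sqrt (2 * pi * (1 / \<kappa>))) ^ CARD('n) = (1 / sqrt (2 * pi)) ^ CARD('n) * \<kappa> powr (real CARD('n) / 2)" .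
  have p: "\<kappa> powr (real CARD('n) / 2 + a - 1) = \<kappa> powr (real CARD('n) / 2) * \<kappa> powr (a - 1)"
    by (simp add: powr_add[symmetric] add_diff_eq)
  have "mvn_density 0 (1 / \<kappa>) y = (1 / sqrt (2 * pi)) ^ CARD('n) * \<kappa> powr (real CARD('n) / 2) * exp (- \<kappa> * ((norm y)\<^sup>2 / 2))"
    using assms by (subst mvn_density_exp) (simp_all only: c, simp_all)
  thus ?thesis unfolding p kappa_prior_def by (simp only: mult_ac)
qed

text \<open>The factors \<open>exp (- v)\<close> of numerator and denominator cancel.\<close>

lemma beta_hat_eq:
  fixes y :: "real ^ 'n"
  assumes q: "0 < real CARD('n) / 2 + a" and b: "0 < b"
  shows "beta_hat a b y = (1 - beta_exp (real CARD('n) / 2 + a + 1) b ((norm y)\<^sup>2 / 2) /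
     beta_exp (real CARD('n) / 2 + a) b ((norm y)\<^sup>2 / 2)) *\<^sub>R y"
proof -
  define v where "v = (norm y)\<^sup>2 / 2"
  have "(LBINT \<kappa>:{0<..<1}. \<kappa> powr (s - 1) * (1 - \<kappa>) powr (b - 1) * exp (- \<kappa> * (norm y)\<^sup>2 / 2)) = exp (- v) * beta_exp s b v"
    if "0 < s" for s
    using has_bochner_integral_integral_eq[OF beta_exp_integral[OF that b, of v]]
    by (simp add: set_lebesgue_integral_def v_def)
  from this[of "real CARD('n) / 2 + a"] this[of "real CARD('n) / 2 + a + 1"] q show ?thesis
    by (simp add: beta_hat_def v_def)
qed

text \<open>The posterior loss is a quadratic function of the decision with positive leading
  coefficient, and \<open>beta_hat\<close> is its vertex, the posterior mean.\<close>

lemma generalized_bayes_beta_hat: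
  assumes q: "0 < real CARD('n) / 2 + a" and b: "0 < b"
    and meas: "(beta_hat a b :: real ^ 'n \<Rightarrow> real ^ 'n) \<in> borel_measurable borel"
  shows "generalized_bayes (beta_prior a b) (beta_hat a b :: real ^ 'n \<Rightarrow> real ^ 'n)"
proof -
  define q where "q = real CARD('n) / 2 + a"
  define C where "C = (1 / sqrt (2 * pi)) ^ CARD('n)"
  have q0: "0 < q" using q by (simp add: q_def)
  have C: "0 < C" by (simp add: C_def)
  have *: "0 < marginal (beta_prior a b) y \<and> marginal (beta_prior a b) y < \<infinity> \<and>
     posterior_loss (beta_prior a b) y (beta_hat a b y) < \<infinity> \<and>
     posterior_loss (beta_prior a b) y (beta_hat a b y) \<le> posterior_loss (beta_prior a b) y d"
     for y d :: "real ^ 'n"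
  proof -
    define v where "v = (norm y)\<^sup>2 / 2"
    have v: "0 \<le> v" by (simp add: v_def)
    define w where "w s \<kappa> = indicator {0<..<1} \<kappa> *\<^sub>R (\<kappa> powr (s - 1) * (1 - \<kappa>) powr (b - 1) * exp (- \<kappa> * v))" for s \<kappa>
    define I where "I s = exp (- v) * beta_exp s b v" for s
    have bi: "has_bochner_integral lborel (w s) (I s)" if "0 < s" for s
      unfolding w_def I_def by (rule beta_exp_integral[OF that b v])
    have Ipos: "0 < I s" if "0 < s" for s
      unfolding I_def using beta_exp_pos[OF that b v] by simp
    have w0: "0 \<le> w s \<kappa>" for s \<kappa> by (simp add: w_def indicator_def)
    have wSuc: "w (s + 1) \<kappa> = \<kappa> * w s \<kappa>" for s \<kappa>
      using powr_add[of \<kappa> "s - 1" 1] by (cases "\<kappa> \<in> {0<..<1}") (auto simp: w_def)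
    have kernel: "ennreal (kappa_prior a b \<kappa> * mvn_density 0 (1 / \<kappa>) y) * indicator {0<..<1} \<kappa> = ennreal (C * w q \<kappa>)" for \<kappa>
      using posterior_kernel[of \<kappa> a b y] by (cases "\<kappa> \<in> {0<..<1}") (auto simp: w_def C_def q_def v_def)
    have "marginal (beta_prior a b) y = (\<integral>\<^sup>+\<beta>. 1 * (ennreal (mvn_density \<beta> 1 y) * beta_prior a b \<beta>) \<partial>lborel)"
      by (simp add: marginal_def)
    also have "\<dots> = (\<integral>\<^sup>+\<kappa>. ennreal (C * w q \<kappa>) \<partial>lborel)"
    proof (subst nn_integral_beta_prior, simp, intro nn_integral_cong)
      fix \<kappa> :: real
      show "ennreal (kappa_prior a b \<kappa> * mvn_density 0 (1 / \<kappa>) y) *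
       (\<integral>\<^sup>+\<beta>. 1 * ennreal (mvn_density ((1 - \<kappa>) *\<^sub>R y) (1 - \<kappa>) \<beta>) \<partial>lborel) * indicator {0<..<1} \<kappa> = ennreal (C * w q \<kappa>)"
        unfolding kernel[symmetric] by (cases "\<kappa> \<in> {0<..<1}") (auto simp: nn_integral_mvn_density)
    qed
    also have "\<dots> = ennreal (C * I q)"
      using has_bochner_integral_mult_right[OF bi[OF q0], of C] C w0
      by (subst nn_integral_eq_integral) (auto simp: has_bochner_integral_iff)
    finally have marg: "marginal (beta_prior a b) y = ennreal (C * I q)" .
    \<comment> \<open>This expands \<open>|d - (1 - \<kappa>) y|^2 + p (1 - \<kappa>)\<close> in
      powers of \<kappa> about \<open>d - y\<close>; each factor \<kappa> raises the index of
      \<open>I\<close> by 1.\<close>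
    define J where "J d = C * (I q * (norm (d - y))\<^sup>2 + I (q + 1) * (2 * ((d - y) \<bullet> y)) + I (q + 2) * (norm y)\<^sup>2
        + real CARD('n) * (I q - I (q + 1)))" for d
    have post: "posterior_loss (beta_prior a b) y d = ennreal (J d) / ennreal (C * I q)" for d
    proof -
      define k where "k \<kappa> = C * (w q \<kappa> * (norm (d - y))\<^sup>2 + w (q + 1) \<kappa> * (2 * ((d - y) \<bullet> y)) + w (q + 2) \<kappa> * (norm y)\<^sup>2
        + real CARD('n) * (w q \<kappa> - w (q + 1) \<kappa>))" for \<kappa>
      have k: "k \<kappa> = C * w q \<kappa> * ((norm (d - (1 - \<kappa>) *\<^sub>R y))\<^sup>2 + real CARD('n) * (1 - \<kappa>))" for \<kappa>
      proof -
        have "d - (1 - \<kappa>) *\<^sub>R y = (d - y) + \<kappa> *\<^sub>R y" by (simp add: algebra_simps)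
        hence n: "(norm (d - (1 - \<kappa>) *\<^sub>R y))\<^sup>2 = (norm (d - y))\<^sup>2 + 2 * \<kappa> * ((d - y) \<bullet> y) + \<kappa>\<^sup>2 * (norm y)\<^sup>2"
          by (simp only: power2_norm_eq_inner) (simp add: inner_add_left inner_add_right inner_commute power2_eq_square)
        have "w (q + 2) \<kappa> = \<kappa> * w (q + 1) \<kappa>" using wSuc[of "q + 1"] by (simp add: add_ac)
        thus ?thesis unfolding n k_def wSuc by (simp add: algebra_simps power2_eq_square)
      qed
      have k0: "0 \<le> k \<kappa>" for \<kappa>
      proof (cases "\<kappa> \<in> {0<..<1}")
        case True
        thus ?thesis unfolding k using C w0[of q \<kappa>] by (intro mult_nonneg_nonneg add_nonneg_nonneg) auto
      qed (simp add: k w_def)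
      have kbi: "has_bochner_integral lborel k (J d)"
        unfolding k_def J_def using q0
        by (intro has_bochner_integral_mult_right has_bochner_integral_add has_bochner_integral_mult_left has_bochner_integral_diff bi) auto
      have "(\<integral>\<^sup>+\<beta>. ennreal ((norm (d - \<beta>))\<^sup>2) * (ennreal (mvn_density \<beta> 1 y) * beta_prior a b \<beta>) \<partial>lborel) = (\<integral>\<^sup>+\<kappa>. ennreal (k \<kappa>) \<partial>lborel)"
      proof (subst nn_integral_beta_prior, simp, intro nn_integral_cong)
        fix \<kappa> :: real
        show "ennreal (kappa_prior a b \<kappa> * mvn_density 0 (1 / \<kappa>) y) *
         (\<integral>\<^sup>+\<beta>. ennreal ((norm (d - \<beta>))\<^sup>2) * ennreal (mvn_density ((1 - \<kappa>) *\<^sub>R y) (1 - \<kappa>) \<beta>) \<partial>lborel) * indicator {0<..<1} \<kappa> = ennreal (k \<kappa>)"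
        proof (cases "\<kappa> \<in> {0<..<1}")
          case True
          have "(\<integral>\<^sup>+\<beta>. ennreal ((norm (d - \<beta>))\<^sup>2) * ennreal (mvn_density ((1 - \<kappa>) *\<^sub>R y) (1 - \<kappa>) \<beta>) \<partial>lborel)
              = ennreal ((norm (d - (1 - \<kappa>) *\<^sub>R y))\<^sup>2 + real CARD('n) * (1 - \<kappa>))"
            using True by (simp add: ennreal_mult[symmetric] nn_integral_mvn_density_sq)
          thus ?thesis using True kernel[of \<kappa>] C w0[of q \<kappa>] unfolding k by (simp add: ennreal_mult)
        qed (simp add: k w_def)
      qed
      also have "\<dots> = ennreal (J d)"
        using kbi k0 by (subst nn_integral_eq_integral) (auto simp: has_bochner_integral_iff)
      finally show ?thesis unfolding posterior_loss_def marg by simp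
    qed
    have CI: "0 < C * I q" using C Ipos[OF q0] by simp
    define r where "r = I (q + 1) / I q"
    have hat: "beta_hat a b y = (1 - r) *\<^sub>R y"
      unfolding beta_hat_eq[OF q b] r_def I_def v_def q_def by simp
    \<comment> \<open>Completing the square: \<open>I (q + 1) = r * I q\<close> makes the terms
      linear in \<open>d - beta_hat a b y\<close> cancel.\<close>
    have "J d - J (beta_hat a b y) = C * I q * (norm (d - beta_hat a b y))\<^sup>2"
    proof -
      have "I (q + 1) = r * I q" using Ipos[OF q0] by (simp add: r_def)
      moreover have "beta_hat a b y - y = - r *\<^sub>R y" "d - beta_hat a b y = (d - y) + r *\<^sub>R y"
        unfolding hat by (simp_all add: algebra_simps)
      ultimately show ?thesis unfolding J_def
        by (simp only: power2_norm_eq_inner) (simp add: inner_add_left inner_add_right inner_commute algebra_simps)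
    qed
    hence "J (beta_hat a b y) \<le> J d" using CI by (metis diff_ge_0_iff_ge less_imp_le mult_nonneg_nonneg zero_le_power2)
    thus ?thesis unfolding marg post using CI
      by (auto intro!: mult_right_mono ennreal_leI simp: divide_ennreal_def ennreal_mult_less_top inverse_ennreal)
  qed
  show ?thesis unfolding generalized_bayes_def using meas * by blast
qed

text \<open>With \<open>H = N / D\<close> the quotient rule gives \<open>H' = H^2 - M / D\<close>,
  and the condition of \<open>minimax_shrinkage\<close> is \<open>shrinkage_inequality\<close>
  multiplied by \<open>2 H\<close>. From \<open>0 < M <= N <= D\<close> follow the bounds on
  \<open>H\<close> and \<open>H'\<close>.\<close>

lemma minimax_beta_hat:
  assumes q: "0 < real CARD('n) / 2 + a" and b: "0 < b" "b < 1"
    and Psi: "0 \<le> Psi b (real CARD('n) / 2 + a)"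
    and P: "real CARD('n) \<ge> 6 * (real CARD('n) / 2 + a + 1) / (b + 2) - (real CARD('n) / 2 + a)"
  shows "minimax (beta_hat a b :: real ^ 'n \<Rightarrow> real ^ 'n)"
proof -
  define q where "q = real CARD('n) / 2 + a"
  have q0: "0 < q" using q by (simp add: q_def)
  define D N M where "D = beta_exp q b" and "N = beta_exp (q + 1) b" and "M = beta_exp (q + 2) b"
  define H where "H v = N v / D v" for v
  define H' where "H' v = (H v)\<^sup>2 - M v / D v" for v
  have pos: "0 < D v" "0 < N v" "0 < M v" if "0 \<le> v" for v
    unfolding D_def N_def M_def using q0 b that by (auto intro!: beta_exp_pos)
  \<comment> \<open>The derivative raises \<open>b\<close>; \<open>beta_exp_split\<close> rewrites
    it as a difference of neighbours in \<open>s\<close>.\<close>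
  have dD: "(D has_real_derivative D v - N v) (at v)" for v
    using beta_exp_deriv[OF q0 b(1), of v] beta_exp_split[OF q0 b(1), of v] by (simp add: D_def N_def)
  have dN: "(N has_real_derivative N v - M v) (at v)" for v
    using beta_exp_deriv[of "q + 1" b v] beta_exp_split[of "q + 1" b v] q0 b by (simp add: N_def M_def add_ac)
  have dM: "(M has_real_derivative beta_exp (q + 2) (b + 1) v) (at v)" for v
    using beta_exp_deriv[of "q + 2" b v] q0 b by (simp add: M_def)
  have ND: "N v \<le> D v" if "0 \<le> v" for v
    using beta_exp_split[OF q0 b(1), of v] beta_exp_pos[of q "b + 1" v] q0 b that by (simp add: D_def N_def)
  have MN: "M v \<le> N v" if "0 \<le> v" for v
    using beta_exp_split[of "q + 1" b v] beta_exp_pos[of "q + 1" "b + 1" v] q0 b that by (simp add: M_def N_def add_ac)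
  have H01: "0 < H v" "H v \<le> 1" if "0 \<le> v" for v
    using pos[OF that] ND[OF that] by (auto simp: H_def)
  have MD: "0 \<le> M v / D v" "M v / D v \<le> 1" if "0 \<le> v" for v
    using pos[OF that] ND[OF that] MN[OF that] by (auto simp: less_imp_le)
  have "minimax (\<lambda>y :: real ^ 'n. (1 - H ((norm y)\<^sup>2 / 2)) *\<^sub>R y)"
  proof (rule minimax_shrinkage[where H' = H'])
    fix v :: real assume v: "0 \<le> v"
    show "(H has_real_derivative H' v) (at v)"
      unfolding H_def[abs_def] using pos[OF v]
      by (auto intro!: derivative_eq_intros dD dN simp: H'_def H_def field_simps power2_eq_square)
    show "\<bar>H v\<bar> \<le> 1" using H01[OF v] by simp
    have "(H v)\<^sup>2 \<le> 1" using H01[OF v] by (simp add: power_le_one)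
    moreover have "0 \<le> (H v)\<^sup>2" by simp
    ultimately show "\<bar>H' v\<bar> \<le> 1" unfolding H'_def using MD[OF v] by linarith
    have "2 * (v * M v / N v) - v * N v / D v \<le> real CARD('n)"
      unfolding M_def N_def D_def using shrinkage_inequality[OF b q0 _ v] Psi P by (simp add: q_def)
    hence "2 * H v * (2 * (v * M v / N v) - v * N v / D v) \<le> 2 * H v * real CARD('n)"
      using H01[OF v] by (intro mult_left_mono) auto
    moreover have "2 * H v * (2 * (v * M v / N v) - v * N v / D v) = 4 * v * (M v / D v) - 2 * v * (H v)\<^sup>2"
      using pos[OF v] by (simp add: H_def field_simps power2_eq_square)
    ultimately show "2 * v * (H v)\<^sup>2 \<le> 2 * real CARD('n) * H v + 4 * v * H' v"
      unfolding H'_def by (simp add: algebra_simps)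
  next
    have "continuous_on {0..} D" "continuous_on {0..} N" "continuous_on {0..} M"
      by (intro continuous_at_imp_continuous_on ballI DERIV_isCont, rule dD dN dM)+
    moreover have "\<forall>v\<in>{0..}. D v \<noteq> 0" using pos(1) by force
    ultimately show "continuous_on {0..} H'"
      unfolding H'_def[abs_def] H_def[abs_def] by (intro continuous_intros) auto
  qed
  also have "(\<lambda>y :: real ^ 'n. (1 - H ((norm y)\<^sup>2 / 2)) *\<^sub>R y) = beta_hat a b"
    using beta_hat_eq[OF q b(1)] by (intro ext) (simp add: H_def N_def D_def q_def)
  finally show ?thesis .
qed

theorem theorem3p1:
  fixes p :: nat and a b :: real
  assumes dim: "CARD('n::finite) = p" and p: "p \<ge> 3"
    and ab: "(- real p / 2 < a \<and> a \<le> - 3 / 2 \<and> 0 < b \<and> b < 1) \<or>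
             (- 3 / 2 < a \<and> a < real p / 2 - 2 \<and>
              (8 * a + 12) / (2 * a + 3 * real p) \<le> b \<and> b < 1)"
    and Psi: "Psi b (real p / 2 + a) \<ge> 0"
  shows "generalized_bayes (beta_prior a b) (beta_hat a b :: real ^ 'n \<Rightarrow> real ^ 'n) \<and>
         minimax (beta_hat a b :: real ^ 'n \<Rightarrow> real ^ 'n)"
proof -
  have q: "0 < real p / 2 + a" using p ab by auto
  have pos: "0 < 2 * a + 3 * real p" using q p by auto
  \<comment> \<open>In case (ii) positivity of \<open>b\<close> follows from its lower bound, whose
    numerator is positive for \<open>a > - 3 / 2\<close>.\<close>
  have b: "0 < b" "b < 1"
  proof -
    have "0 < (8 * a + 12) / (2 * a + 3 * real p)" if "- 3 / 2 < a"
      using that pos by (intro divide_pos_pos) auto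
    thus "0 < b" using ab by (meson less_le_trans)
    show "b < 1" using ab by auto
  qed
  \<comment> \<open>With \<open>q = p / 2 + a\<close>, this is
    \<open>6 (q + 1) / (b + 2) - q <= p\<close> cleared of denominators. In case (i) the left-hand
    side is nonpositive.\<close>
  have "8 * a + 12 \<le> b * (2 * a + 3 * real p)"
  proof (cases "a \<le> - 3 / 2")
    case True
    hence "8 * a + 12 \<le> 0" by simp
    also have "0 \<le> b * (2 * a + 3 * real p)" using b pos by simp
    finally show ?thesis .
  next
    case False
    thus ?thesis using ab pos by (auto simp: pos_divide_le_eq)
  qed
  hence P: "real p \<ge> 6 * (real p / 2 + a + 1) / (b + 2) - (real p / 2 + a)"
    using b by (simp add: field_simps)
  have mm: "minimax (beta_hat a b :: real ^ 'n \<Rightarrow> real ^ 'n)"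
    using q b Psi P by (intro minimax_beta_hat) (simp_all add: dim)
  \<comment> \<open>The measurability that a Bayes estimator must have is a component of
    minimaxity.\<close>
  moreover have "generalized_bayes (beta_prior a b) (beta_hat a b :: real ^ 'n \<Rightarrow> real ^ 'n)"
    using q b mm by (intro generalized_bayes_beta_hat) (simp_all add: dim minimax_def)
  ultimately show ?thesis by simp
qed

end
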